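(* Let $I,\overline J,\mathsf h$ be as in the context and let $\mathrm{Asso}_{I,\overline J}(\mathsf h)$ be the polyhedral complex of bounded cells of the subdivision of $\{x\in\mathbb{R}^{\overline J}:x_{\overline j_{\max}}=0\}$ induced by the arrangement $(H_i)_{i\in I}$. Then the poset of cells of $\mathrm{Asso}_{I,\overline J}(\mathsf h)$ is anti-isomorphic to the poset of interior faces of the $(I,\overline J)$-Tamari complex. In particular: (1) its faces correspond to covering $(I,\overline J)$-forests; (2) its vertices correspond to $(I,\overline J)$-trees; (3) two vertices are joined by an edge if and only if the corresponding trees are related by a flip, so that the edge graph of $\mathrm{Asso}_{I,\overline J}(\mathsf h)$ is isomorphic to the Hasse diagram of the $(I,\overline J)$-Tamari poset.
   Context: $\mathbb{N}=\{0,1,\dots\}$, $\overline{\mathbb{N}}$ a disjoint copy, totally ordered by $i\prec\overline i\prec i+1$. $I\subset\mathbb{N}$, $\overline J\subset\overline{\mathbb{N}}$ are nonempty finite with $\min(I\sqcup\overline J)\in I$ and $\overline j_{\max}:=\max(I\sqcup\overline J)\in\overline J$. An $(I,\overline J)$-forest is a set of arcs $(i,\overline j)\in I\times\overline J$ with $i\le j$ for every arc and no two arcs $(i,\overline j),(i',\overline{j'})$ with $i<i'\le j<j'$; an $(I,\overline J)$-tree is a maximal one; it is covering if it contains the arc $(\min I,\overline j_{\max})$ and has no isolated node of $I\sqcup\overline J$. The $(I,\overline J)$-Tamari complex is the simplicial complex of $(I,\overline J)$-forests; interior faces are those not contained in its boundary (the subcomplex generated by codimension-one faces lying in exactly one facet).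 Two trees are related by a flip if they differ in exactly one arc; the $(I,\overline J)$-Tamari poset is the transitive closure of the increasing flips $T\to (T\setminus\{(i,\overline j)\})\cup\{(i',\overline{j'})\}$ with $i'>i$, $j'>j$. $\mathsf h$ is a real function on $\{(i,\overline j)\in I\times\overline J: i\le j\}$ such that $\mathsf h(i,\overline{j'})+\mathsf h(i',\overline j)<\mathsf h(i,\overline j)+\mathsf h(i',\overline{j'})$ whenever $i<i'\le j<j'$; set $\mathsf h(i,\overline j)=+\infty$ if $j<i$. For $i\in I$, $H_i=\{x\in\mathbb{R}^{\overline J}: \max_{\overline j\in\overline J}(x_{\overline j}-\mathsf h(i,\overline j))\text{ is attained at least twice}\}$ (an inverted, possibly degenerate, tropical hyperplane). The arrangement subdivides space into closed polyhedral cells: for each point $x$ record, for each $i\in I$, the set of indices $\overline j$ attaining the maximum; the cells are the closures of the sets of points with a common such record. *)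

theory Defs
  imports "HOL-Analysis.Analysis"
begin

text \<open>
  The disjoint copy of the natural numbers is again represented by the type of naturals, and an arc
  from \<open>i\<close> to the barred node \<open>j\<close> by the pair \<open>(i, j)\<close>. In the order \<open>0, bar 0, 1, bar 1, \<dots>\<close> the node
  \<open>i\<close> precedes \<open>bar j\<close> iff \<open>i \<le> j\<close>, and \<open>bar j\<close> precedes \<open>i\<close> iff \<open>j < i\<close>. So the least node of
  \<open>I\<close> and \<open>bar J\<close> together lies in \<open>I\<close> iff \<open>Min I \<le> Min J\<close>, and the greatest lies in \<open>bar J\<close> iff
  \<open>Max I \<le> Max J\<close>, in which case it is \<open>bar (Max J)\<close>.
\<close>

type_synonym arc = "nat \<times> nat"

definition forest :: "nat set \<Rightarrow> nat set \<Rightarrow> arc set \<Rightarrow> bool" where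
  "forest I J F \<longleftrightarrow>
     F \<subseteq> I \<times> J \<and>
     (\<forall>(i, j)\<in>F. i \<le> j) \<and>
     \<not> (\<exists>i j i' j'. (i, j) \<in> F \<and> (i', j') \<in> F \<and> i < i' \<and> i' \<le> j \<and> j < j')"

definition tree :: "nat set \<Rightarrow> nat set \<Rightarrow> arc set \<Rightarrow> bool" where
  "tree I J T \<longleftrightarrow> forest I J T \<and> (\<forall>F. forest I J F \<and> T \<subseteq> F \<longrightarrow> F = T)"

definition covering_forest :: "nat set \<Rightarrow> nat set \<Rightarrow> arc set \<Rightarrow> bool" where
  "covering_forest I J F \<longleftrightarrow>
     forest I J F \<and> (Min I, Max J) \<in> F \<and>
     (\<forall>i\<in>I. \<exists>j. (i, j) \<in> F) \<and> (\<forall>j\<in>J. \<exists>i. (i, j) \<in> F)"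


text \<open>Finite simplicial complexes, given as the set of all their faces, the empty face included.\<close>

definition facets :: "'a set set \<Rightarrow> 'a set set" where
  "facets K = {T \<in> K. \<forall>F\<in>K. T \<subseteq> F \<longrightarrow> F = T}"

definition codim_one_faces :: "'a set set \<Rightarrow> 'a set set" where
  "codim_one_faces K = {R \<in> K. card R + 1 = Max (card ` K)}"

definition boundary_complex :: "'a set set \<Rightarrow> 'a set set" where
  "boundary_complex K =
     {F \<in> K. \<exists>R \<in> codim_one_faces K. F \<subseteq> R \<and> card {T \<in> facets K. R \<subseteq> T} = 1}"

definition interior_faces :: "'a set set \<Rightarrow> 'a set set" where
  "interior_faces K = K - boundary_complex K"

definition tamari_complex :: "nat set \<Rightarrow> nat set \<Rightarrow> arc set set" where
  "tamari_complex I J = {F. forest I J F}"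


definition flip_related :: "nat set \<Rightarrow> nat set \<Rightarrow> arc set \<Rightarrow> arc set \<Rightarrow> bool" where
  "flip_related I J T T' \<longleftrightarrow>
     tree I J T \<and> tree I J T' \<and> card (T - T') = 1 \<and> card (T' - T) = 1"

definition increasing_flip :: "nat set \<Rightarrow> nat set \<Rightarrow> arc set \<Rightarrow> arc set \<Rightarrow> bool" where
  "increasing_flip I J T T' \<longleftrightarrow>
     tree I J T \<and> tree I J T' \<and>
     (\<exists>i j i' j'. (i, j) \<in> T \<and> i < i' \<and> j < j' \<and> T' = (T - {(i, j)}) \<union> {(i', j')})"

definition tamari_le :: "nat set \<Rightarrow> nat set \<Rightarrow> arc set \<Rightarrow> arc set \<Rightarrow> bool" where
  "tamari_le I J T T' \<longleftrightarrow>
     tree I J T \<and> tree I J T' \<and> (increasing_flip I J)\<^sup>*\<^sup>* T T'"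

definition tamari_covers :: "nat set \<Rightarrow> nat set \<Rightarrow> arc set \<Rightarrow> arc set \<Rightarrow> bool" where
  "tamari_covers I J T T' \<longleftrightarrow>
     tamari_le I J T T' \<and> T \<noteq> T' \<and>
     (\<forall>S. tamari_le I J T S \<and> tamari_le I J S T' \<longrightarrow> S = T \<or> S = T')"

text \<open>Adjacency in the Hasse diagram, regarded as an undirected graph.\<close>

definition hasse_adjacent :: "nat set \<Rightarrow> nat set \<Rightarrow> arc set \<Rightarrow> arc set \<Rightarrow> bool" where
  "hasse_adjacent I J T T' \<longleftrightarrow> tamari_covers I J T T' \<or> tamari_covers I J T' T"


text \<open>The coordinates of \<open>real ^ 'n\<close> are labelled by the elements of \<open>J\<close> through a bijection
  \<open>e :: 'n \<Rightarrow> nat\<close> onto \<open>J\<close>; so \<open>x $ k\<close> is the coordinate with index \<open>bar (e k)\<close>.\<close>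

definition height :: "(nat \<Rightarrow> nat \<Rightarrow> real) \<Rightarrow> nat \<Rightarrow> nat \<Rightarrow> ereal" where
  "height h i j = (if i \<le> j then ereal (h i j) else \<infinity>)"

definition maximizers ::
    "('n::finite \<Rightarrow> nat) \<Rightarrow> (nat \<Rightarrow> nat \<Rightarrow> real) \<Rightarrow> nat \<Rightarrow> real ^ 'n \<Rightarrow> 'n set" where
  "maximizers e h i x =
     {k. ereal (x $ k) - height h i (e k) =
           Max (range (\<lambda>l. ereal (x $ l) - height h i (e l)))}"

definition trop_hyperplane ::
    "('n::finite \<Rightarrow> nat) \<Rightarrow> (nat \<Rightarrow> nat \<Rightarrow> real) \<Rightarrow> nat \<Rightarrow> (real ^ 'n) set" where
  "trop_hyperplane e h i = {x. 2 \<le> card (maximizers e h i x)}"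

text \<open>The record of \<open>x\<close> is the family of sets \<open>maximizers e h i x\<close>, \<open>i \<in> I\<close>. Since \<open>x\<close> lies on
  \<open>trop_hyperplane e h i\<close> iff the corresponding set has at least two elements, the records
  determine the subdivision induced by the arrangement of these hyperplanes.\<close>

definition slice :: "('n::finite \<Rightarrow> nat) \<Rightarrow> (real ^ 'n) set" where
  "slice e = {x. \<forall>k. e k = Max (range e) \<longrightarrow> x $ k = 0}"

definition cells ::
    "nat set \<Rightarrow> ('n::finite \<Rightarrow> nat) \<Rightarrow> (nat \<Rightarrow> nat \<Rightarrow> real) \<Rightarrow> (real ^ 'n) set set" where
  "cells I e h =
     (\<lambda>x. closure {y \<in> slice e. \<forall>i\<in>I. maximizers e h i y = maximizers e h i x}) ` slice e"

definition Asso ::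
    "nat set \<Rightarrow> ('n::finite \<Rightarrow> nat) \<Rightarrow> (nat \<Rightarrow> nat \<Rightarrow> real) \<Rightarrow> (real ^ 'n) set set" where
  "Asso I e h = {C \<in> cells I e h. bounded C}"

definition Asso_vertices ::
    "nat set \<Rightarrow> ('n::finite \<Rightarrow> nat) \<Rightarrow> (nat \<Rightarrow> nat \<Rightarrow> real) \<Rightarrow> (real ^ 'n) set set" where
  "Asso_vertices I e h = {C \<in> Asso I e h. aff_dim C = 0}"

definition joined_by_edge ::
    "nat set \<Rightarrow> ('n::finite \<Rightarrow> nat) \<Rightarrow> (nat \<Rightarrow> nat \<Rightarrow> real) \<Rightarrow>
     (real ^ 'n) set \<Rightarrow> (real ^ 'n) set \<Rightarrow> bool" where
  "joined_by_edge I e h u v \<longleftrightarrow>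
     u \<in> Asso_vertices I e h \<and> v \<in> Asso_vertices I e h \<and> u \<noteq> v \<and>
     (\<exists>E \<in> Asso I e h. aff_dim E = 1 \<and> u \<subseteq> E \<and> v \<subseteq> E)"

end

theory Submission
  imports Defs
begin

text \<open>
  The maximizers of a point form a forest by the crossing inequality for the heights, and a cell is
  bounded iff its forest is covering: otherwise an explicit recession direction exists. Conversely, a
  covering forest occurs at some point because a noncrossing set of arcs is the unique cheapest way
  to match its endpoints, so that shortest path distances provide the coordinates of the point. A
  cell thus consists of the points whose forest contains a given one, which reverses the order.

  A line through the relative interior of a bounded cell leaves it at both ends, and the forest
  strictly grows there. Hence trees give single points, and a covering forest with one arc less
  than a tree gives a segment and lies in two trees; a forest that is not covering lies in a
  forest of that size which is contained in only one tree.
\<close>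

section \<open>Forests and trees\<close>

text \<open>The boundary of the complex is defined by counting facets, so all trees must have the
  same size and a covering forest one arc short must lie in more than one tree. The size comes from
  an arc that belongs to every tree and has an end of degree one. The second tree is found
  geometrically, so \<open>interior_faces_eq\<close> takes its existence as a hypothesis, discharged
  only once the cells are understood. No general dimension formula for cells is derived: only
  dimensions 0 and 1 matter, and these are decided by the equations that one missing arc leaves
  free. The Hasse diagram needs an argument of its own, since an increasing flip might a priori be a
  composite of others. The longest arc at each left node and the leftmost arc at each right node
  never move back under increasing flips, and a single flip changes one entry of each, which leaves
  no room for a composite.\<close>

lemma forest_iff:
  "forest I J F \<longleftrightarrow> F \<subseteq> I \<times> J \<and> (\<forall>i j. (i, j) \<in> F \<longrightarrow> i \<le> j) \<and>
     (\<forall>i j i' j'. (i, j) \<in> F \<longrightarrow> (i', j') \<in> F \<longrightarrow> i < i' \<longrightarrow> i' \<le> j \<longrightarrow> j' \<le> j)"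
  unfolding forest_def case_prod_beta not_ex de_Morgan_conj not_less[symmetric]
  by (simp only: Ball_def split_paired_All fst_conv snd_conv) meson

lemma forestD:
  assumes "forest I J F" "(i, j) \<in> F"
  shows "i \<in> I" "j \<in> J" "i \<le> j"
  using assms by (auto simp: forest_iff)

lemma forest_noncrossing:
  assumes "forest I J F" "(i, j) \<in> F" "(i', j') \<in> F" "i < i'" "i' \<le> j"
  shows "j' \<le> j"
  using assms unfolding forest_iff by metis

lemma forest_subset: "forest I J F \<Longrightarrow> G \<subseteq> F \<Longrightarrow> forest I J G"
  unfolding forest_iff by (meson subset_eq)

lemma forest_change_nodes: "forest I J F \<Longrightarrow> F \<subseteq> I' \<times> J' \<Longrightarrow> forest I' J' F"
  unfolding forest_iff by simp

text \<open>The last two premises exclude the two ways of crossing: the new arc starts first, or it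
  starts second.\<close>

lemma forest_insertI:
  assumes "forest I J F" "i \<in> I" "j \<in> J" "i \<le> j"
    and "\<And>a b. (a, b) \<in> F \<Longrightarrow> i < a \<Longrightarrow> a \<le> j \<Longrightarrow> b \<le> j"
    and "\<And>a b. (a, b) \<in> F \<Longrightarrow> a < i \<Longrightarrow> i \<le> b \<Longrightarrow> j \<le> b"
  shows "forest I J (insert (i, j) F)"
  using assms unfolding forest_iff by simp

lemma finite_forests:
  assumes "finite I" "finite J"
  shows "finite {F. forest I J F}"
proof (rule finite_subset)
  show "{F. forest I J F} \<subseteq> Pow (I \<times> J)"
    by (auto simp: forest_def)
qed (use assms in auto)

lemma finite_forest: "finite I \<Longrightarrow> finite J \<Longrightarrow> forest I J F \<Longrightarrow> finite F"
  unfolding forest_def using finite_subset by blast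

lemma tree_forest: "tree I J T \<Longrightarrow> forest I J T"
  by (simp add: tree_def)

lemma tree_eqI: "tree I J T \<Longrightarrow> forest I J F \<Longrightarrow> T \<subseteq> F \<Longrightarrow> F = T"
  by (simp add: tree_def)

lemma tree_memI:
  assumes "tree I J T" "i \<in> I" "j \<in> J" "i \<le> j"
    and "\<And>a b. (a, b) \<in> T \<Longrightarrow> i < a \<Longrightarrow> a \<le> j \<Longrightarrow> b \<le> j"
    and "\<And>a b. (a, b) \<in> T \<Longrightarrow> a < i \<Longrightarrow> i \<le> b \<Longrightarrow> j \<le> b"
  shows "(i, j) \<in> T"
proof -
  have "forest I J (insert (i, j) T)"
    by (rule forest_insertI[OF tree_forest[OF assms(1)] assms(2-4)]) (use assms(5,6) in blast)+
  then show ?thesis using tree_eqI[OF assms(1)] by blast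
qed

lemma ex_tree_superset:
  assumes "finite I" "finite J" "forest I J F"
  obtains T where "tree I J T" "F \<subseteq> T"
proof -
  from finite_has_maximal2[OF finite_forests[OF assms(1,2)], of F] assms(3)
  obtain T where "forest I J T" "F \<subseteq> T" "\<forall>G. forest I J G \<longrightarrow> T \<subseteq> G \<longrightarrow> T = G"
    by auto
  then show thesis
    by (intro that[of T]) (auto simp: tree_def)
qed

section \<open>Node sets on which every tree is covering\<close>

locale nodes =
  fixes I J :: "nat set"
  assumes finI: "finite I" and neI: "I \<noteq> {}" and finJ: "finite J" and neJ: "J \<noteq> {}"
    and Min_IJ: "Min I \<le> Min J" and Max_IJ: "Max I \<le> Max J"
begin

lemma Min_I: "Min I \<in> I" and Max_I: "Max I \<in> I" and Max_J: "Max J \<in> J"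
  using finI neI finJ neJ by auto

lemma le_I: "i \<in> I \<Longrightarrow> Min I \<le> i" and I_le: "i \<in> I \<Longrightarrow> i \<le> Max J"
  and le_J: "j \<in> J \<Longrightarrow> Min I \<le> j" and J_le: "j \<in> J \<Longrightarrow> j \<le> Max J"
proof -
  show "Min I \<le> i" "i \<le> Max J" if "i \<in> I"
    using that finI Max_IJ Max_ge[OF finI that] by (simp, linarith)
  show "Min I \<le> j" "j \<le> Max J" if "j \<in> J"
    using that Min_IJ finJ Min_le[OF finJ that] by (linarith, simp)
qed

lemma long_arc_in_tree:
  assumes "tree I J T"
  shows "(Min I, Max J) \<in> T"
proof (rule tree_memI[OF assms Min_I Max_J])
  show "Min I \<le> Max J" by (rule I_le[OF Min_I])
  show "b \<le> Max J" if "(a, b) \<in> T" for a b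
    using J_le forestD[OF tree_forest[OF assms] that] by blast
  show "Max J \<le> b" if "(a, b) \<in> T" "a < Min I" for a b
    using le_I[OF forestD(1)[OF tree_forest[OF assms] that(1)]] that(2) by simp
qed

text \<open>Consider the arcs passing over \<open>i\<close>, a nonempty family because of the long
  arc. An arc from \<open>i\<close> to the nearest of their right ends crosses none of them, and
  arcs starting beyond \<open>i\<close> are kept inside by the chosen one.\<close>

lemma tree_covers_I:
  assumes T: "tree I J T" and i: "i \<in> I"
  obtains j where "(i, j) \<in> T"
proof (cases "i = Min I")
  case True
  then show thesis using long_arc_in_tree[OF T] that by blast
next
  case False
  note F = tree_forest[OF T]
  have fin: "finite T" by (rule finite_forest[OF finI finJ F])
  define B where "B = {b. \<exists>a. (a, b) \<in> T \<and> a < i \<and> i \<le> b}"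
  have "B \<subseteq> snd ` T" unfolding B_def by force
  then have finB: "finite B" using fin finite_subset by blast
  have "Max J \<in> B"
    unfolding B_def using long_arc_in_tree[OF T] I_le[OF i] le_I[OF i] False
    by (auto intro!: exI[of _ "Min I"])
  then have "Min B \<in> B" using finB Min_in by blast
  then obtain a where a: "(a, Min B) \<in> T" "a < i" "i \<le> Min B"
    unfolding B_def by blast
  have "(i, Min B) \<in> T"
  proof (rule tree_memI[OF T i])
    show "Min B \<in> J" using forestD[OF F a(1)] by blast
    show "i \<le> Min B" by fact
    show "d \<le> Min B" if "(c, d) \<in> T" "i < c" "c \<le> Min B" for c d
      using forest_noncrossing[OF F a(1) that(1)] that a(2) by linarith
    show "Min B \<le> d" if "(c, d) \<in> T" "c < i" "i \<le> d" for c d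
      using that finB unfolding B_def by (intro Min.coboundedI) auto
  qed
  then show thesis by (rule that)
qed

text \<open>Mirror image of the argument for left nodes: join \<open>j\<close> to the nearest left
  end of an arc passing strictly over it.\<close>

lemma tree_covers_J:
  assumes T: "tree I J T" and j: "j \<in> J"
  obtains i where "(i, j) \<in> T"
proof (cases "j = Max J")
  case True
  then show thesis using long_arc_in_tree[OF T] that by blast
next
  case False
  note F = tree_forest[OF T]
  have fin: "finite T" by (rule finite_forest[OF finI finJ F])
  define B where "B = {a. \<exists>b. (a, b) \<in> T \<and> a \<le> j \<and> j < b}"
  have "B \<subseteq> fst ` T" unfolding B_def by force
  then have finB: "finite B" using fin finite_subset by blast
  have "Min I \<in> B"
    unfolding B_def using long_arc_in_tree[OF T] J_le[OF j] le_J[OF j] False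
    by (auto intro!: exI[of _ "Max J"])
  then have "Max B \<in> B" using finB Max_in by blast
  then obtain b where b: "(Max B, b) \<in> T" "Max B \<le> j" "j < b"
    unfolding B_def by blast
  have "(Max B, j) \<in> T"
  proof (rule tree_memI[OF T _ j b(2)])
    show "Max B \<in> I" using forestD[OF F b(1)] by blast
    show "d \<le> j" if "(c, d) \<in> T" "Max B < c" "c \<le> j" for c d
    proof (rule ccontr)
      assume "\<not> d \<le> j"
      then have "c \<in> B" using that unfolding B_def by auto
      then show False using Max.coboundedI[OF finB] that(2) by fastforce
    qed
    show "j \<le> d" if "(c, d) \<in> T" "c < Max B" "Max B \<le> d" for c d
      using forest_noncrossing[OF F that(1) b(1)] that b by linarith
  qed
  then show thesis by (rule that)
qed

lemma tree_covering: "tree I J T \<Longrightarrow> covering_forest I J T"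
  unfolding covering_forest_def
  using tree_forest long_arc_in_tree tree_covers_I tree_covers_J by metis

end

text \<open>Induction on the number of nodes. With \<open>a\<close> the last left node and
  \<open>b\<close> the first right node after it, no node separates them, so the arc
  \<open>(a, b)\<close> lies in every tree; moreover one of its ends is a leaf and can be
  deleted.\<close>

lemma tree_card:
  assumes "nodes I J" "tree I J T"
  shows "card T + 1 = card I + card J"
  using assms
proof (induction "card I + card J" arbitrary: I J T rule: less_induct)
  case less
  interpret nodes I J by fact
  note T = less.prems(2)
  note F = tree_forest[OF T]
  have fin: "finite T" by (rule finite_forest[OF finI finJ F])
  define a where "a = Max I"
  define b where "b = Min {j \<in> J. a \<le> j}"
  have a: "a \<in> I" "\<And>i. i \<in> I \<Longrightarrow> i \<le> a"
    using Max_I finI by (auto simp: a_def)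
  have "b \<in> {j \<in> J. a \<le> j}"
    unfolding b_def using finJ Max_J I_le[OF a(1)] by (intro Min_in) auto
  then have b: "b \<in> J" "a \<le> b" by auto
  have b_min: "b \<le> j" if "j \<in> J" "a \<le> j" for j
    unfolding b_def using that finJ by (intro Min_le) auto
  have nocross: "\<not> (a < c \<and> c \<le> b)" "\<not> (c < a \<and> a \<le> d \<and> d < b)"
    if "c \<in> I" "d \<in> J" for c d
    using a(2)[OF that(1)] b_min[OF that(2)] by auto
  have insert_ab: "forest I J (insert (a, b) G)" if "forest I J G" for G
    using a(1) b nocross forestD[OF that] that
    by (intro forest_insertI) (blast, blast, blast, blast, meson not_le, meson not_le)
  then have ab: "(a, b) \<in> T"
    using tree_eqI[OF T] F by blast
  \<comment> \<open>Maximality descends: \<open>(a, b)\<close> can be added back to any forest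
    \<open>G\<close> on the smaller node sets, and the result, containing \<open>T\<close>, must be
    \<open>T\<close>.\<close>
  have restrict: "tree I' J' (T - {(a, b)})"
    if sub: "I' \<subseteq> I" "J' \<subseteq> J" and T': "forest I' J' (T - {(a, b)})" and ab': "a \<notin> I' \<or> b \<notin> J'"
    for I' J'
    unfolding tree_def
  proof (intro conjI allI impI)
    fix G assume G: "forest I' J' G \<and> T - {(a, b)} \<subseteq> G"
    then have "G \<subseteq> I \<times> J" using sub forestD[of I' J' G] by auto
    then have "forest I J G" using G forest_change_nodes by blast
    then have "forest I J (insert (a, b) G)" by (rule insert_ab)
    then have "insert (a, b) G = T" using tree_eqI[OF T] G by blast
    moreover have "(a, b) \<notin> G" using G ab' forestD by blast
    ultimately show "G = T - {(a, b)}" by blast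
  qed (use T' in blast)
  have card_T: "card T = card (T - {(a, b)}) + 1"
    using card_Suc_Diff1[OF fin ab] by simp
  show ?case
  proof (cases "\<forall>j. (a, j) \<in> T \<longrightarrow> j = b")
    case True
    show ?thesis
    proof (cases "I = {a}")
      \<comment> \<open>The base of the induction: deleting \<open>a\<close> would leave no left
        node, but here all right nodes hang on \<open>a\<close>, so \<open>J = {b}\<close>.\<close>
      case I: True
      have "(a, j) \<in> T" if "j \<in> J" for j
        using tree_covers_J[OF T that] forestD(1)[OF F] I by blast
      then have "J = {b}" using True b by blast
      moreover have "T = {(a, b)}" 
        using ab F I \<open>J = {b}\<close> unfolding forest_def by auto
      ultimately show ?thesis using I by simp
    next
      case I: False
      have "Min I \<noteq> a"
      proof
        assume "Min I = a"
        then have "i = a" if "i \<in> I" for i using le_I[OF that] a(2)[OF that] by simp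
        then show False using I a(1) by blast
      qed
      then have "Min I \<in> I - {a}" using Min_I by blast
      moreover have "nodes (I - {a}) J"
      proof
        show "I - {a} \<noteq> {}" using \<open>Min I \<in> I - {a}\<close> by blast
        have "Min (I - {a}) \<le> Min I"
          using finI \<open>Min I \<in> I - {a}\<close> by simp
        then show "Min (I - {a}) \<le> Min J" using Min_IJ by simp
        have "Max (I - {a}) \<in> I - {a}"
          using finI \<open>I - {a} \<noteq> {}\<close> by (meson Max_in finite_Diff)
        then show "Max (I - {a}) \<le> Max J" using I_le by blast
      qed (use finI finJ neJ in auto)
      moreover have "forest (I - {a}) J (T - {(a, b)})"
        using forestD[OF F] True
        by (intro forest_change_nodes[OF forest_subset[OF F]]) auto
      ultimately have "card (T - {(a, b)}) + 1 = card (I - {a}) + card J"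
        using less.hyps[of "I - {a}" J "T - {(a, b)}"] restrict[of "I - {a}" J]
          card_Diff1_less[OF finI a(1)] by simp
      then show ?thesis using card_T card_Suc_Diff1[OF finI a(1)] by simp
    qed
  next
    case False
    then obtain j where j: "(a, j) \<in> T" "j \<noteq> b" by blast
    have "j \<in> J" "a \<le> j" using forestD[OF F j(1)] by auto
    then have "b < j" using b_min j(2) by fastforce
    \<comment> \<open>An arc \<open>(i, b)\<close> with \<open>i < a\<close> would cross
      \<open>(a, j)\<close>, so now \<open>b\<close> is the leaf.\<close>
    have only: "i = a" if "(i, b) \<in> T" for i
      using forest_noncrossing[OF F that j(1)] \<open>b < j\<close> a(2) b(2) forestD(1)[OF F that]
      by fastforce
    have "nodes I (J - {b})"
    proof
      show "J - {b} \<noteq> {}" using \<open>j \<in> J\<close> j by blast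
      then have "Min (J - {b}) \<in> J - {b}" "Max (J - {b}) \<in> J - {b}"
        using finJ by (meson Min_in Max_in finite_Diff)+
      then show "Min I \<le> Min (J - {b})" using le_J by blast
      have "j \<le> Max (J - {b})" using finJ \<open>j \<in> J\<close> j by simp
      then show "Max I \<le> Max (J - {b})" using \<open>a \<le> j\<close> a_def by simp
    qed (use finI finJ neI in auto)
    moreover have "forest I (J - {b}) (T - {(a, b)})"
      using forestD[OF F] only
      by (intro forest_change_nodes[OF forest_subset[OF F]]) auto
    ultimately have "card (T - {(a, b)}) + 1 = card I + card (J - {b})"
      using less.hyps[of I "J - {b}" "T - {(a, b)}"] restrict[of I "J - {b}"]
        card_Diff1_less[OF finJ b(1)] by simp
    then show ?thesis using card_T card_Suc_Diff1[OF finJ b(1)] by simp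
  qed
qed

section \<open>Interior faces of the Tamari complex\<close>

context nodes
begin

lemma forest_card_le:
  assumes "forest I J F"
  shows "card F + 1 \<le> card I + card J"
proof -
  obtain T where T: "tree I J T" "F \<subseteq> T"
    using ex_tree_superset[OF finI finJ assms] .
  have "card F \<le> card T"
    using T finite_forest[OF finI finJ tree_forest] card_mono by metis
  then show ?thesis using tree_card[OF nodes_axioms T(1)] by simp
qed

lemma tree_iff_card: "tree I J T \<longleftrightarrow> forest I J T \<and> card T + 1 = card I + card J"
proof
  assume T: "forest I J T \<and> card T + 1 = card I + card J"
  show "tree I J T"
    unfolding tree_def
  proof (intro conjI allI impI)
    fix F assume F: "forest I J F \<and> T \<subseteq> F"
    then have "card F \<le> card T" using forest_card_le[of F] T by simp
    then show "F = T"
      using F finite_forest[OF finI finJ] card_seteq by metis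
  qed (use T in blast)
qed (use tree_card[OF nodes_axioms] tree_forest in blast)

lemma covering_forestD:
  assumes "covering_forest I J F"
  shows "forest I J F" "(Min I, Max J) \<in> F"
  using assms by (auto simp: covering_forest_def)

lemma covering_arc_I:
  assumes "covering_forest I J F" "i \<in> I"
  obtains j where "(i, j) \<in> F"
  using assms unfolding covering_forest_def by blast

lemma covering_arc_J:
  assumes "covering_forest I J F" "j \<in> J"
  obtains i where "(i, j) \<in> F"
  using assms unfolding covering_forest_def by blast

lemma covering_mono:
  "covering_forest I J F \<Longrightarrow> F \<subseteq> G \<Longrightarrow> forest I J G \<Longrightarrow> covering_forest I J G"
  unfolding covering_forest_def by (meson subsetD)

lemma facets_eq: "facets (tamari_complex I J) = {T. tree I J T}"
  by (auto simp: facets_def tamari_complex_def tree_def)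

lemma codim_one_iff:
  "R \<in> codim_one_faces (tamari_complex I J) \<longleftrightarrow> forest I J R \<and> card R + 2 = card I + card J"
proof -
  have "forest I J {}" by (simp add: forest_iff)
  then obtain T where T: "tree I J T" using ex_tree_superset[OF finI finJ] by blast
  have "Max (card ` tamari_complex I J) = card T"
  proof (rule Max_eqI)
    show "finite (card ` tamari_complex I J)"
      by (simp add: tamari_complex_def finite_forests[OF finI finJ])
    show "n \<le> card T" if "n \<in> card ` tamari_complex I J" for n
      using that forest_card_le tree_card[OF nodes_axioms T] by (fastforce simp: tamari_complex_def)
    show "card T \<in> card ` tamari_complex I J"
      using tree_forest[OF T] by (simp add: tamari_complex_def)
  qed
  then show ?thesis
    using tree_card[OF nodes_axioms T] by (auto simp: codim_one_faces_def tamari_complex_def)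
qed

lemma tree_eq_insert:
  assumes "tree I J T" "card R + 2 = card I + card J" "R \<subseteq> T" "x \<in> T" "x \<notin> R"
  shows "T = insert x R"
proof -
  have fin: "finite T" using finite_forest[OF finI finJ tree_forest[OF assms(1)]] .
  then have "card (insert x R) = card T"
    using assms tree_card[OF nodes_axioms assms(1)] finite_subset[OF assms(3)] by simp
  then show ?thesis
    using card_subset_eq[OF fin, of "insert x R"] assms by simp
qed

text \<open>Each tree over \<open>R\<close> adds a single arc. What \<open>R\<close> lacks, the long
  arc or an arc at some node, must be supplied by it, so the two added arcs coincide or share an
  end. Arcs with a common end never cross, hence one tree can absorb the arc of the other.\<close>

lemma noncovering_unique_tree:
  assumes R: "card R + 2 = card I + card J" "\<not> covering_forest I J R"
    and T: "tree I J T" "R \<subseteq> T" and T': "tree I J T'" "R \<subseteq> T'"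
  shows "T = T'"
proof -
  have FR: "forest I J R" using forest_subset[OF tree_forest[OF T(1)] T(2)] .
  have shared: "T = T'"
    if x: "(i, j) \<in> T" "(i', j') \<in> T'" "(i, j) \<notin> R" "(i', j') \<notin> R" and eq: "i = i' \<or> j = j'"
    for i j i' j'
  proof -
    have TR: "T = insert (i, j) R" and TR': "T' = insert (i', j') R"
      using tree_eq_insert[OF T(1) R(1) T(2)] tree_eq_insert[OF T'(1) R(1) T'(2)] x by blast+
    have "forest I J (insert (i, j) T')"
    proof (rule forest_insertI[OF tree_forest[OF T'(1)]])
      show "i \<in> I" "j \<in> J" "i \<le> j" using forestD[OF tree_forest[OF T(1)] x(1)] by auto
      note nc = forest_noncrossing[OF tree_forest[OF T(1)]]
      show "b \<le> j" if "(a, b) \<in> T'" "i < a" "a \<le> j" for a b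
        using that eq nc[OF x(1), of a b] unfolding TR' TR by auto
      show "j \<le> b" if "(a, b) \<in> T'" "a < i" "i \<le> b" for a b
        using that eq nc[of a b i j] unfolding TR' TR by auto
    qed
    then have "insert (i, j) T' = T'" using tree_eqI[OF T'(1)] by blast
    then have "T \<subseteq> T'" unfolding TR using T'(2) by auto
    then show ?thesis using tree_eqI[OF T(1) tree_forest[OF T'(1)]] by simp
  qed
  consider "(Min I, Max J) \<notin> R" | i where "i \<in> I" "\<forall>j. (i, j) \<notin> R" | j where "j \<in> J" "\<forall>i. (i, j) \<notin> R"
    using R(2) FR unfolding covering_forest_def by blast
  then show ?thesis
  proof cases
    case 1
    then show ?thesis using shared long_arc_in_tree T(1) T'(1) by blast
  next
    case 2
    obtain j j' where "(i, j) \<in> T" "(i, j') \<in> T'"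
      using 2 tree_covers_I[OF T(1)] tree_covers_I[OF T'(1)] by metis
    then show ?thesis using shared 2 by blast
  next
    case 3
    obtain i i' where "(i, j) \<in> T" "(i', j) \<in> T'"
      using 3 tree_covers_J[OF T(1)] tree_covers_J[OF T'(1)] by metis
    then show ?thesis using shared 3 by blast
  qed
qed

text \<open>Without the long arc, delete it from a tree above \<open>F\<close>; otherwise take a
  tree on the nodes without the isolated one, which has exactly one arc less. The long arc
  guarantees that the deleted node is neither \<open>Min I\<close> nor \<open>Max J\<close>, so the
  node conditions survive.\<close>

lemma noncovering_extend:
  assumes F: "forest I J F" "\<not> covering_forest I J F"
  obtains R where "F \<subseteq> R" "forest I J R" "card R + 2 = card I + card J" "\<not> covering_forest I J R"
proof (cases "(Min I, Max J) \<in> F")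
  case False
  obtain T where T: "tree I J T" "F \<subseteq> T" using ex_tree_superset[OF finI finJ F(1)] .
  show thesis
  proof (rule that)
    show "F \<subseteq> T - {(Min I, Max J)}" using T False by blast
    show "forest I J (T - {(Min I, Max J)})"
      using forest_subset[OF tree_forest[OF T(1)]] by blast
    show "card (T - {(Min I, Max J)}) + 2 = card I + card J"
      using card_Suc_Diff1[OF finite_forest[OF finI finJ tree_forest[OF T(1)]] long_arc_in_tree[OF T(1)]]
        tree_card[OF nodes_axioms T(1)] by simp
    show "\<not> covering_forest I J (T - {(Min I, Max J)})"
      by (simp add: covering_forest_def)
  qed
next
  case long: True
  consider i where "i \<in> I" "\<forall>j. (i, j) \<notin> F" | j where "j \<in> J" "\<forall>i. (i, j) \<notin> F"
    using F long unfolding covering_forest_def by blast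
  then show thesis
  proof cases
    case 1
    have ne: "Min I \<in> I - {i}" using 1 long Min_I by auto
    have "nodes (I - {i}) J"
    proof
      show "I - {i} \<noteq> {}" using ne by blast
      have "Min (I - {i}) \<le> Min I" using finI ne by simp
      then show "Min (I - {i}) \<le> Min J" using Min_IJ by simp
      have "Max (I - {i}) \<in> I - {i}" using finI ne by (metis Max_in empty_iff finite_Diff)
      then show "Max (I - {i}) \<le> Max J" using I_le by blast
    qed (use finI finJ neJ in auto)
    moreover have "forest (I - {i}) J F"
      by (rule forest_change_nodes[OF F(1)]) (use forestD[OF F(1)] 1 in auto)
    then obtain R where R: "tree (I - {i}) J R" "F \<subseteq> R"
      using ex_tree_superset[of "I - {i}" J] finI finJ by blast
    ultimately have "card R + 1 = card (I - {i}) + card J" using tree_card by blast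
    then have "card R + 2 = card I + card J" using card_Suc_Diff1[OF finI 1(1)] by simp
    moreover have "forest I J R"
      by (rule forest_change_nodes[OF tree_forest[OF R(1)]]) (use forestD[OF tree_forest[OF R(1)]] in auto)
    moreover have "\<not> covering_forest I J R"
      using forestD[OF tree_forest[OF R(1)]] 1(1) unfolding covering_forest_def by blast
    ultimately show thesis using that R(2) by blast
  next
    case 2
    have ne: "Max J \<in> J - {j}" using 2 long Max_J by auto
    have "nodes I (J - {j})"
    proof
      show "J - {j} \<noteq> {}" using ne by blast
      have "Max J \<le> Max (J - {j})" using finJ ne by simp
      then show "Max I \<le> Max (J - {j})" using Max_IJ by simp
      have "Min (J - {j}) \<in> J - {j}" using finJ ne by (metis Min_in empty_iff finite_Diff)
      then show "Min I \<le> Min (J - {j})" using le_J by blast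
    qed (use finI finJ neI in auto)
    moreover have "forest I (J - {j}) F"
      by (rule forest_change_nodes[OF F(1)]) (use forestD[OF F(1)] 2 in auto)
    then obtain R where R: "tree I (J - {j}) R" "F \<subseteq> R"
      using ex_tree_superset[of I "J - {j}"] finI finJ by blast
    ultimately have "card R + 1 = card I + card (J - {j})" using tree_card by blast
    then have "card R + 2 = card I + card J" using card_Suc_Diff1[OF finJ 2(1)] by simp
    moreover have "forest I J R"
      by (rule forest_change_nodes[OF tree_forest[OF R(1)]]) (use forestD[OF tree_forest[OF R(1)]] in auto)
    moreover have "\<not> covering_forest I J R"
      using forestD[OF tree_forest[OF R(1)]] 2(1) unfolding covering_forest_def by blast
    ultimately show thesis using that R(2) by blast
  qed
qed

text \<open>The hypothesis \<open>two\<close> keeps covering faces of codimension one off the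
  boundary. Being covering passes to larger forests, so a face inside a non-covering one is
  non-covering too.\<close>

lemma interior_faces_eq:
  assumes two: "\<And>R. covering_forest I J R \<Longrightarrow> card R + 2 = card I + card J \<Longrightarrow>
    \<exists>T T'. tree I J T \<and> tree I J T' \<and> R \<subseteq> T \<and> R \<subseteq> T' \<and> T \<noteq> T'"
  shows "interior_faces (tamari_complex I J) = {F. covering_forest I J F}"
proof -
  have "F \<in> boundary_complex (tamari_complex I J) \<longleftrightarrow> \<not> covering_forest I J F"
    if F: "forest I J F" for F
  proof
    assume "F \<in> boundary_complex (tamari_complex I J)"
    then obtain R where R: "forest I J R" "card R + 2 = card I + card J" "F \<subseteq> R"
      and 1: "card {T \<in> {T. tree I J T}. R \<subseteq> T} = 1"
      unfolding boundary_complex_def mem_Collect_eq Bex_def codim_one_iff facets_eq by blast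
    obtain T where "{T \<in> {T. tree I J T}. R \<subseteq> T} = {T}"
      using card_1_singletonE[OF 1] by blast
    then have uniq: "S = T" if "tree I J S" "R \<subseteq> S" for S using that by auto
    have "\<not> covering_forest I J R" using two[OF _ R(2)] uniq by metis
    then show "\<not> covering_forest I J F" using covering_mono R by blast
  next
    assume "\<not> covering_forest I J F"
    then obtain R where R: "F \<subseteq> R" "forest I J R" "card R + 2 = card I + card J" "\<not> covering_forest I J R"
      using noncovering_extend[OF F] by blast
    obtain T where T: "tree I J T" "R \<subseteq> T" using ex_tree_superset[OF finI finJ R(2)] .
    then have "{T \<in> {T. tree I J T}. R \<subseteq> T} = {T}"
      using noncovering_unique_tree[OF R(3,4)] by blast
    then have "card {T \<in> facets (tamari_complex I J). R \<subseteq> T} = 1" unfolding facets_eq by simp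
    then show "F \<in> boundary_complex (tamari_complex I J)"
      using R F codim_one_iff[of R] unfolding boundary_complex_def tamari_complex_def by blast
  qed
  moreover have "forest I J F" if "covering_forest I J F" for F
    using that by (simp add: covering_forest_def)
  ultimately show ?thesis
    unfolding interior_faces_def tamari_complex_def by blast
qed

text \<open>Two distinct trees contain the intersection, which a non-covering forest of this size
  does not allow.\<close>

lemma flip_intersection:
  assumes "flip_related I J T T'"
  shows "card (T \<inter> T') + 2 = card I + card J" "covering_forest I J (T \<inter> T')"
proof -
  have T: "tree I J T" and T': "tree I J T'" and 1: "card (T - T') = 1"
    using assms by (auto simp: flip_related_def)
  have "card (T \<inter> T') + card (T - T') = card T"
    using card_Int_Diff[OF finite_forest[OF finI finJ tree_forest[OF T]]] by simp
  then show c: "card (T \<inter> T') + 2 = card I + card J"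
    using 1 tree_card[OF nodes_axioms T] by simp
  have "T \<noteq> T'" using 1 by auto
  then show "covering_forest I J (T \<inter> T')"
    using noncovering_unique_tree[OF c _ T _ T'] by blast
qed

lemma flip_relatedI:
  assumes "tree I J T" "tree I J T'" "T \<noteq> T'" "R \<subseteq> T" "R \<subseteq> T'" "card R + 2 = card I + card J"
  shows "flip_related I J T T'" "R = T \<inter> T'"
proof -
  obtain x y where x: "x \<in> T" "x \<notin> R" and y: "y \<in> T'" "y \<notin> R"
    using assms tree_card[OF nodes_axioms, of T] tree_card[OF nodes_axioms, of T']
    by (metis add_left_cancel nat_1_add_1 one_neq_zero add.assoc add_cancel_left_right subsetI subset_antisym)
  have "T = insert x R" "T' = insert y R"
    using tree_eq_insert assms x y by blast+
  moreover have "x \<noteq> y" using calculation assms(3) by blast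
  ultimately have "T - T' = {x}" "T' - T = {y}" "R = T \<inter> T'" using x y by auto
  then show "flip_related I J T T'" "R = T \<inter> T'" using assms by (auto simp: flip_related_def)
qed

end

section \<open>Flips and cover relations\<close>

text \<open>Together with \<open>leftmost_arc\<close>, a statistic that detects the direction of
  flips. It is meaningful only at nodes carrying an arc.\<close>

definition longest_arc :: "arc set \<Rightarrow> nat \<Rightarrow> nat" where
  "longest_arc T i = Max {j. (i, j) \<in> T}"

definition leftmost_arc :: "arc set \<Rightarrow> nat \<Rightarrow> nat" where
  "leftmost_arc T j = Min {i. (i, j) \<in> T}"

lemma finite_arcs:
  assumes "finite T"
  shows "finite {j. (i, j) \<in> T}" "finite {i. (i, j) \<in> T}"
proof -
  have "{j. (i, j) \<in> T} \<subseteq> snd ` T" "{i. (i, j) \<in> T} \<subseteq> fst ` T" by force+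
  then show "finite {j. (i, j) \<in> T}" "finite {i. (i, j) \<in> T}"
    using assms finite_subset by blast+
qed

lemma longest_arc_eqI:
  "finite T \<Longrightarrow> (i, j) \<in> T \<Longrightarrow> (\<And>b. (i, b) \<in> T \<Longrightarrow> b \<le> j) \<Longrightarrow> longest_arc T i = j"
  unfolding longest_arc_def using finite_arcs(1) by (intro Max_eqI) auto

lemma leftmost_arc_eqI:
  "finite T \<Longrightarrow> (i, j) \<in> T \<Longrightarrow> (\<And>a. (a, j) \<in> T \<Longrightarrow> i \<le> a) \<Longrightarrow> leftmost_arc T j = i"
  unfolding leftmost_arc_def using finite_arcs(2) by (intro Min_eqI) auto

lemma longest_arc_in:
  assumes "finite T" "(i, j) \<in> T"
  shows "(i, longest_arc T i) \<in> T" "j \<le> longest_arc T i"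
proof -
  have "Max {j. (i, j) \<in> T} \<in> {j. (i, j) \<in> T}"
    using assms finite_arcs(1) by (intro Max_in) auto
  then show "(i, longest_arc T i) \<in> T" by (simp add: longest_arc_def)
  show "j \<le> longest_arc T i"
    unfolding longest_arc_def using assms finite_arcs(1) by (intro Max_ge) auto
qed

lemma leftmost_arc_in:
  assumes "finite T" "(i, j) \<in> T"
  shows "(leftmost_arc T j, j) \<in> T" "leftmost_arc T j \<le> i"
proof -
  have "Min {i. (i, j) \<in> T} \<in> {i. (i, j) \<in> T}"
    using assms finite_arcs(2) by (intro Min_in) auto
  then show "(leftmost_arc T j, j) \<in> T" by (simp add: leftmost_arc_def)
  show "leftmost_arc T j \<le> i"
    unfolding leftmost_arc_def using assms finite_arcs(2) by (intro Min_le) auto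
qed

section \<open>The effect of one increasing flip\<close>

locale flip_up = nodes +
  fixes T T' :: "arc set" and i j i' j' :: nat
  assumes T: "tree I J T" and T': "tree I J T'"
    and ij: "(i, j) \<in> T" and less: "i < i'" "j < j'"
    and T'_eq: "T' = (T - {(i, j)}) \<union> {(i', j')}"
begin

lemmas F = tree_forest[OF T] and F' = tree_forest[OF T']

lemma fin: "finite T" "finite T'"
  using finite_forest[OF finI finJ] F F' by blast+

lemma ij': "(i', j') \<in> T'"
  by (simp add: T'_eq)

lemma old_arc: "(a, b) \<in> T \<Longrightarrow> (a, b) \<noteq> (i, j) \<Longrightarrow> (a, b) \<in> T'"
  by (simp add: T'_eq)

lemma new_arc: "(a, b) \<in> T' \<Longrightarrow> (a, b) \<noteq> (i', j') \<Longrightarrow> (a, b) \<in> T"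
  by (auto simp: T'_eq)

text \<open>If the exchanged arcs did not cross, \<open>(i, j)\<close> would cross nothing in
  \<open>T'\<close> and could be put back.\<close>

lemma crossing: "i' \<le> j"
proof (rule ccontr)
  assume far: "\<not> i' \<le> j"
  have "(i, j) \<in> T'"
  proof (rule tree_memI[OF T'])
    show "i \<in> I" "j \<in> J" "i \<le> j" using forestD[OF F ij] by auto
    show "b \<le> j" if "(a, b) \<in> T'" "i < a" "a \<le> j" for a b
      using forest_noncrossing[OF F ij new_arc[OF that(1)]] that far by auto
    show "j \<le> b" if "(a, b) \<in> T'" "a < i" "i \<le> b" for a b
      using forest_noncrossing[OF F new_arc[OF that(1)] ij] that less by auto
  qed
  then show False using T'_eq less by simp
qed

text \<open>The exchanged arcs are the diagonals of a quadrilateral with \<open>(i, j')\<close> and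
  \<open>(i', j)\<close> as opposite sides. An arc of \<open>T\<close> crossing
  \<open>(i, j')\<close> would cross \<open>(i, j)\<close> inside \<open>T\<close> or
  \<open>(i', j')\<close> inside \<open>T'\<close>.\<close>

lemma i_longer_arc: "(i, j') \<in> T"
proof (rule tree_memI[OF T])
  show "i \<in> I" "j' \<in> J" "i \<le> j'"
    using forestD[OF F ij] forestD[OF F' ij'] less by auto
  show "b \<le> j'" if ab: "(a, b) \<in> T" "i < a" "a \<le> j'" for a b
  proof (cases "a \<le> j")
    case True
    then show ?thesis using forest_noncrossing[OF F ij ab(1)] ab less by simp
  next
    case False
    then show ?thesis
      using forest_noncrossing[OF F' ij' old_arc[OF ab(1)]] ab crossing by auto
  qed
  show "j' \<le> b" if ab: "(a, b) \<in> T" "a < i" "i \<le> b" for a b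
  proof -
    have "j \<le> b" using forest_noncrossing[OF F ab(1) ij ab(2,3)] .
    then show ?thesis
      using forest_noncrossing[OF F' old_arc[OF ab(1)] ij'] ab crossing less by auto
  qed
qed

lemma i'_arc: "(i', j) \<in> T"
proof (rule tree_memI[OF T])
  show "i' \<in> I" "j \<in> J" "i' \<le> j"
    using forestD[OF F ij] forestD[OF F' ij'] crossing by auto
  show "b \<le> j" if ab: "(a, b) \<in> T" "i' < a" "a \<le> j" for a b
    using forest_noncrossing[OF F ij ab(1)] ab less by simp
  show "j \<le> b" if ab: "(a, b) \<in> T" "a < i'" "i' \<le> b" for a b
    using forest_noncrossing[OF F' old_arc[OF ab(1)] ij' ab(2,3)] less by fastforce
qed

lemma longest_arc_old: "longest_arc T i' = j"
  by (rule longest_arc_eqI[OF fin(1) i'_arc])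
    (use forest_noncrossing[OF F ij] less crossing in blast)

lemma longest_arc_new: "longest_arc T' i' = j'"
  by (rule longest_arc_eqI[OF fin(2) ij'])
    (use longest_arc_in[OF fin(1)] longest_arc_old new_arc less in force)

text \<open>The removed arc is not the longest at \<open>i\<close>, since \<open>(i, j')\<close> is
  longer; so only the value at \<open>i'\<close> moves.\<close>

lemma longest_arc_other:
  assumes "a \<in> I" "a \<noteq> i'"
  shows "longest_arc T' a = longest_arc T a"
proof -
  obtain b where "(a, b) \<in> T" using tree_covers_I[OF T assms(1)] .
  note in_T = longest_arc_in[OF fin(1), of a]
  have "longest_arc T i \<noteq> j" using longest_arc_in(2)[OF fin(1) i_longer_arc] less by simp
  then have "(a, longest_arc T a) \<in> T'"
    using in_T(1)[OF \<open>(a, b) \<in> T\<close>] old_arc by blast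
  then show ?thesis
    by (rule longest_arc_eqI[OF fin(2)]) (use in_T(2) new_arc assms in blast)
qed

lemma leftmost_arc_old: "leftmost_arc T j = i"
proof (rule leftmost_arc_eqI[OF fin(1) ij])
  show "i \<le> a" if "(a, j) \<in> T" for a
    using forest_noncrossing[OF F' old_arc[OF that] ij'] crossing less by force
qed

lemma leftmost_arc_new: "leftmost_arc T' j = i'"
proof (rule leftmost_arc_eqI[OF fin(2)])
  show "(i', j) \<in> T'" using i'_arc old_arc less by blast
  show "i' \<le> a" if "(a, j) \<in> T'" for a
    using forest_noncrossing[OF F' that ij'] crossing less by force
qed

text \<open>The added arc is not leftmost at \<open>j'\<close>, since \<open>(i, j')\<close> starts
  earlier and survives the flip; so only the value at \<open>j\<close> moves.\<close>

lemma leftmost_arc_other: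
  assumes "b \<in> J" "b \<noteq> j"
  shows "leftmost_arc T' b = leftmost_arc T b"
proof -
  obtain a where "(a, b) \<in> T" using tree_covers_J[OF T assms(1)] .
  note in_T = leftmost_arc_in[OF fin(1), of _ b]
  have "(leftmost_arc T b, b) \<in> T'"
    using in_T(1)[OF \<open>(a, b) \<in> T\<close>] old_arc assms by blast
  moreover have "leftmost_arc T b \<le> c" if "(c, b) \<in> T'" for c
    using in_T(2)[of c] new_arc[OF that] leftmost_arc_in(2)[OF fin(1) i_longer_arc] less by force
  ultimately show ?thesis by (rule leftmost_arc_eqI[OF fin(2)])
qed

lemma longest_arc_le: "a \<in> I \<Longrightarrow> longest_arc T a \<le> longest_arc T' a"
  using longest_arc_other longest_arc_old longest_arc_new less by (cases "a = i'") auto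

lemma leftmost_arc_le: "b \<in> J \<Longrightarrow> leftmost_arc T b \<le> leftmost_arc T' b"
  using leftmost_arc_other leftmost_arc_old leftmost_arc_new less by (cases "b = j") auto

lemma new_nodes: "i' \<in> I" "j \<in> J"
  using forestD[OF F i'_arc] by auto

end

section \<open>Chains of flips and cover relations\<close>

context nodes
begin

lemma increasing_flipE:
  assumes "increasing_flip I J T T'"
  obtains i j i' j' where "flip_up I J T T' i j i' j'"
  using assms nodes_axioms unfolding increasing_flip_def flip_up_def flip_up_axioms_def by blast

lemma rtranclp_flip_mono:
  assumes "(increasing_flip I J)\<^sup>*\<^sup>* T T'"
  shows "(\<forall>a\<in>I. longest_arc T a \<le> longest_arc T' a) \<and> (\<forall>b\<in>J. leftmost_arc T b \<le> leftmost_arc T' b)"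
  using assms
proof (induction rule: rtranclp_induct)
  case (step S S')
  obtain i j i' j' where "flip_up I J S S' i j i' j'" using increasing_flipE[OF step(2)] .
  then show ?case
    using step.IH flip_up.longest_arc_le flip_up.leftmost_arc_le order_trans by meson
qed simp

lemma increasing_flip_irreversible:
  assumes "increasing_flip I J T S" "(increasing_flip I J)\<^sup>*\<^sup>* S T"
  shows False
proof -
  obtain i j i' j' where "flip_up I J T S i j i' j'" using increasing_flipE[OF assms(1)] .
  then interpret flip_up I J T S i j i' j' .
  show False
    using rtranclp_flip_mono[OF assms(2)] new_nodes longest_arc_old longest_arc_new less by fastforce
qed

text \<open>A flip moves a single \<open>longest_arc\<close> and a single \<open>leftmost_arc\<close> entry. If two flips composed
  below a third one, all three would move the same two entries, but the first flip already takes
  the \<open>leftmost_arc\<close> entry to its final value.\<close>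

lemma increasing_flip_indecomposable:
  assumes "increasing_flip I J T T'" "increasing_flip I J T S1" "increasing_flip I J S1 S2"
    and "(increasing_flip I J)\<^sup>*\<^sup>* S2 T'"
  shows False
proof -
  obtain i j i' j' where "flip_up I J T T' i j i' j'" using increasing_flipE[OF assms(1)] .
  then interpret A: flip_up I J T T' i j i' j' .
  obtain i1 j1 i1' j1' where "flip_up I J T S1 i1 j1 i1' j1'" using increasing_flipE[OF assms(2)] .
  then interpret B: flip_up I J T S1 i1 j1 i1' j1' .
  obtain i2 j2 i2' j2' where "flip_up I J S1 S2 i2 j2 i2' j2'" using increasing_flipE[OF assms(3)] .
  then interpret C: flip_up I J S1 S2 i2 j2 i2' j2' .
  note le = rtranclp_flip_mono[OF assms(4)]
  have "longest_arc T i1' < longest_arc S1 i1'"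
    using B.longest_arc_old B.longest_arc_new B.less by simp
  also have "\<dots> \<le> longest_arc S2 i1'" using C.longest_arc_le B.new_nodes(1) .
  also have "\<dots> \<le> longest_arc T' i1'" using le B.new_nodes(1) by blast
  finally have 1: "i1' = i'" using A.longest_arc_other B.new_nodes(1) by fastforce
  have "longest_arc T i2' \<le> longest_arc S1 i2'" using B.longest_arc_le C.new_nodes(1) .
  also have "\<dots> < longest_arc S2 i2'"
    using C.longest_arc_old C.longest_arc_new C.less by simp
  also have "\<dots> \<le> longest_arc T' i2'" using le C.new_nodes(1) by blast
  finally have 2: "i2' = i'" using A.longest_arc_other C.new_nodes(1) by fastforce
  have "leftmost_arc T j1 < leftmost_arc S1 j1"
    using B.leftmost_arc_old B.leftmost_arc_new B.less by simp
  also have "\<dots> \<le> leftmost_arc S2 j1" using C.leftmost_arc_le B.new_nodes(2) .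
  also have "\<dots> \<le> leftmost_arc T' j1" using le B.new_nodes(2) by blast
  finally have 3: "j1 = j" using A.leftmost_arc_other B.new_nodes(2) by fastforce
  have "leftmost_arc T j2 \<le> leftmost_arc S1 j2" using B.leftmost_arc_le C.new_nodes(2) .
  also have "\<dots> < leftmost_arc S2 j2"
    using C.leftmost_arc_old C.leftmost_arc_new C.less by simp
  also have "\<dots> \<le> leftmost_arc T' j2" using le C.new_nodes(2) by blast
  finally have 4: "j2 = j" using A.leftmost_arc_other C.new_nodes(2) by fastforce
  show False
    using B.leftmost_arc_new C.leftmost_arc_old C.less 1 2 3 4 by simp
qed

text \<open>A covering pair is joined by a chain whose first flip must already be all of it.
  Conversely, a tree strictly between the ends of a flip would put at least two flips on a path
  between them.\<close>

lemma tamari_covers_iff: "tamari_covers I J T T' \<longleftrightarrow> increasing_flip I J T T'"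
proof
  assume cov: "tamari_covers I J T T'"
  then have T: "tree I J T" "tree I J T'" "T \<noteq> T'" "(increasing_flip I J)\<^sup>*\<^sup>* T T'"
    by (auto simp: tamari_covers_def tamari_le_def)
  obtain S where S: "increasing_flip I J T S" "(increasing_flip I J)\<^sup>*\<^sup>* S T'"
    using converse_rtranclpE[OF T(4)] T(3) by metis
  have "tree I J S" using S(1) by (simp add: increasing_flip_def)
  then have "S = T \<or> S = T'"
    using cov S T unfolding tamari_covers_def tamari_le_def by blast
  then show "increasing_flip I J T T'"
    using S increasing_flip_irreversible by blast
next
  assume up: "increasing_flip I J T T'"
  then have T: "tree I J T" "tree I J T'" by (auto simp: increasing_flip_def)
  have "S = T \<or> S = T'" if TS: "(increasing_flip I J)\<^sup>*\<^sup>* T S" and ST': "(increasing_flip I J)\<^sup>*\<^sup>* S T'" for S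
  proof (rule ccontr)
    assume ne: "\<not> (S = T \<or> S = T')"
    obtain S1 where S1: "increasing_flip I J T S1" "(increasing_flip I J)\<^sup>*\<^sup>* S1 S"
      using converse_rtranclpE[OF TS] ne by metis
    obtain S2 where S2: "increasing_flip I J S S2" "(increasing_flip I J)\<^sup>*\<^sup>* S2 T'"
      using converse_rtranclpE[OF ST'] ne by metis
    \<comment> \<open>The second flip of the path either still leads towards \<open>S\<close> or,
      when \<open>S1 = S\<close>, is the first flip after \<open>S\<close>.\<close>
    obtain R where R: "increasing_flip I J S1 R" "(increasing_flip I J)\<^sup>*\<^sup>* R T'"
      using S1(2)
    proof (cases rule: converse_rtranclpE)
      case base
      then show thesis using that S2 by blast
    next
      case (step R)
      then show thesis using that ST' rtranclp_trans by metis
    qed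
    show False by (rule increasing_flip_indecomposable[OF up S1(1) R])
  qed
  moreover have "T \<noteq> T'" using increasing_flip_irreversible[OF up] by blast
  ultimately show "tamari_covers I J T T'"
    using T up unfolding tamari_covers_def tamari_le_def by blast
qed

lemma increasing_flip_flip_related:
  assumes "increasing_flip I J T T'"
  shows "flip_related I J T T'"
proof -
  obtain i j i' j' where "flip_up I J T T' i j i' j'" using increasing_flipE[OF assms(1)] .
  then interpret flip_up I J T T' i j i' j' .
  have "T \<noteq> T'" using increasing_flip_irreversible[OF assms] by blast
  show ?thesis
  proof (rule flip_relatedI[OF T T' \<open>T \<noteq> T'\<close>])
    show "T - {(i, j)} \<subseteq> T" "T - {(i, j)} \<subseteq> T'" using T'_eq by auto
    show "card (T - {(i, j)}) + 2 = card I + card J"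
      using card_Suc_Diff1[OF fin(1) ij] tree_card[OF nodes_axioms T] by simp
  qed
qed

lemma flip_related_sym: "flip_related I J T T' \<Longrightarrow> flip_related I J T' T"
  by (simp add: flip_related_def)

text \<open>If the two exchanged arcs did not cross, the removed one could be put back into
  \<open>T'\<close>; the way in which they cross decides which flip increases.\<close>

lemma flip_related_increasing:
  assumes "flip_related I J T T'"
  shows "increasing_flip I J T T' \<or> increasing_flip I J T' T"
proof -
  have T: "tree I J T" and T': "tree I J T'"
    and 1: "card (T - T') = 1" "card (T' - T) = 1"
    using assms by (auto simp: flip_related_def)
  obtain i j where ij: "T - T' = {(i, j)}" using card_1_singletonE[OF 1(1)] by auto
  obtain i' j' where ij': "T' - T = {(i', j')}" using card_1_singletonE[OF 1(2)] by auto
  have eq: "T' = (T - {(i, j)}) \<union> {(i', j')}" "T = (T' - {(i', j')}) \<union> {(i, j)}"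
    and mem: "(i, j) \<in> T" "(i', j') \<in> T'" and not_mem: "(i, j) \<notin> T'"
    using ij ij' by blast+
  have "(i < i' \<and> i' \<le> j \<and> j < j') \<or> (i' < i \<and> i \<le> j' \<and> j' < j)"
  proof (rule ccontr)
    assume nc: "\<not> ?thesis"
    note F = tree_forest[OF T]
    have "(i, j) \<in> T'"
    proof (rule tree_memI[OF T'])
      show "i \<in> I" "j \<in> J" "i \<le> j" using forestD[OF F mem(1)] by auto
      show "b \<le> j" if "(a, b) \<in> T'" "i < a" "a \<le> j" for a b
        using forest_noncrossing[OF F mem(1), of a b] that nc eq(1) by auto
      show "j \<le> b" if "(a, b) \<in> T'" "a < i" "i \<le> b" for a b
        using forest_noncrossing[OF F _ mem(1), of a b] that nc eq(1) by auto
    qed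
    then show False using not_mem by blast
  qed
  then show ?thesis
    unfolding increasing_flip_def using T T' eq mem by blast
qed

lemma hasse_adjacent_iff: "hasse_adjacent I J T T' \<longleftrightarrow> flip_related I J T T'"
  unfolding hasse_adjacent_def tamari_covers_iff
  using increasing_flip_flip_related flip_related_increasing flip_related_sym by blast

end

section \<open>Forests as optimal matchings\<close>

locale strict_monge = nodes +
  fixes h :: "nat \<Rightarrow> nat \<Rightarrow> real"
  assumes monge: "\<And>i i' j j'. i \<in> I \<Longrightarrow> i' \<in> I \<Longrightarrow> j \<in> J \<Longrightarrow> j' \<in> J \<Longrightarrow>
    i < i' \<Longrightarrow> i' \<le> j \<Longrightarrow> j < j' \<Longrightarrow> h i j' + h i' j < h i j + h i' j'"
begin

definition admissible :: "arc set" where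
  "admissible = {(i, j). i \<in> I \<and> j \<in> J \<and> i \<le> j}"

definition total :: "arc multiset \<Rightarrow> real" where
  "total M = (\<Sum>(i, j)\<in>#M. h i j)"

lemma total_add_mset [simp]: "total (add_mset (i, j) M) = h i j + total M"
  and total_empty [simp]: "total {#} = 0"
  by (simp_all add: total_def)

text \<open>Among all multisets of arcs with prescribed endpoints, noncrossing ones minimise the total
  height. The largest left end \<open>a\<close> and the least right end \<open>b \<ge> a\<close> are joined in \<open>N\<close>, and they can
  be joined in \<open>M\<close> as well by resolving one crossing, after which the arc \<open>(a, b)\<close> is removed
  from both.\<close>

lemma forest_total_le:
  assumes "forest I J F" "set_mset N \<subseteq> F" "set_mset M \<subseteq> admissible"
    and "image_mset fst M = image_mset fst N" "image_mset snd M = image_mset snd N"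
  shows "total N \<le> total M"
  using assms(2-)
proof (induction "size N" arbitrary: M N rule: less_induct)
  case less
  show ?case
  proof (cases "N = {#}")
    case True
    then show ?thesis using less.prems by simp
  next
    case False
    have fst_eq: "fst ` set_mset M = fst ` set_mset N" and snd_eq: "snd ` set_mset M = snd ` set_mset N"
      using less.prems by (metis set_image_mset)+
    define a where "a = Max (fst ` set_mset N)"
    have "a \<in> fst ` set_mset N" unfolding a_def using False by (intro Max_in) auto
    then obtain b1 where b1: "(a, b1) \<in># N" by force
    have a_max: "c \<le> a" if "(c, d) \<in># N" for c d
      unfolding a_def using that by (intro Max_ge) force+
    define B where "B = {d \<in> snd ` set_mset N. a \<le> d}"
    define b where "b = Min B"
    have finB: "finite B" by (simp add: B_def)
    have "b1 \<in> B" using b1 forestD(3)[OF assms(1), of a b1] less.prems(1) by (force simp: B_def)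
    then have "b \<in> B" "b \<le> b1" unfolding b_def using finB by (auto intro: Min_in)
    then obtain a1 where a1: "(a1, b) \<in># N" and ab: "a \<le> b" by (force simp: B_def)
    have b_min: "b \<le> d" if "d \<in> snd ` set_mset N" "a \<le> d" for d
      unfolding b_def using finB that by (intro Min_le) (auto simp: B_def)
    have abN: "(a, b) \<in># N"
    proof (cases "a1 = a \<or> b1 = b")
      case True
      then show ?thesis using a1 b1 by auto
    next
      case no: False
      then have "b1 \<le> b"
        using forest_noncrossing[OF assms(1), of a1 b a b1] a_max[OF a1] ab a1 b1 less.prems(1)
        by (simp add: subset_iff)
      then show ?thesis using no \<open>b \<le> b1\<close> by simp
    qed
    then obtain N' where N': "N = add_mset (a, b) N'" by (metis multi_member_split)
    show ?thesis
    proof (cases "(a, b) \<in># M")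
      case True
      then obtain M' where M': "M = add_mset (a, b) M'" by (metis multi_member_split)
      have "total N' \<le> total M'"
        by (rule less.hyps) (use less.prems in \<open>auto simp: N' M'\<close>)
      then show ?thesis by (simp add: N' M')
    next
      case notM: False
      have "a \<in> fst ` set_mset M" "b \<in> snd ` set_mset M"
        using abN fst_eq snd_eq by force+
      then obtain b2 a2 where b2: "(a, b2) \<in># M" and a2: "(a2, b) \<in># M" by force
      have adm: "a \<in> I" "b2 \<in> J" "a \<le> b2" "a2 \<in> I" "b \<in> J" "a2 \<le> b"
        using b2 a2 less.prems(2) by (auto simp: admissible_def)
      have "b2 \<in> snd ` set_mset N" "a2 \<in> fst ` set_mset N"
        using a2 b2 fst_eq snd_eq by force+
      then have "b \<le> b2" "a2 \<le> a" using b_min adm a_max by auto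
      moreover have "b \<noteq> b2" "a2 \<noteq> a" using notM a2 b2 by auto
      ultimately have lt: "a2 < a" "b < b2" by auto
      obtain M1 where M1: "M = add_mset (a, b2) M1" using b2 by (metis multi_member_split)
      have "(a2, b) \<in># M1" using a2 M1 lt by auto
      then obtain M2 where M2: "M1 = add_mset (a2, b) M2" by (metis multi_member_split)
      have "total N' \<le> total (add_mset (a2, b2) M2)"
        by (rule less.hyps) (use less.prems adm lt in \<open>auto simp: N' M1 M2 admissible_def\<close>)
      moreover have "h a2 b2 + h a b < h a2 b + h a b2"
        using monge adm lt ab by blast
      ultimately show ?thesis by (simp add: N' M1 M2)
    qed
  qed
qed

text \<open>The potentials are shortest path distances from \<open>Min I\<close> in the graph whose edges are the
  admissible arcs and the reversed arcs of \<open>F\<close>, a path being recorded only by the multisets \<open>M\<close> of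
  its forward and \<open>N\<close> of its backward steps. Covering makes this graph strongly connected.\<close>

lemma potential_exists:
  assumes cov: "covering_forest I J F"
  obtains x z :: "nat \<Rightarrow> real"
  where "\<And>i j. i \<in> I \<Longrightarrow> j \<in> J \<Longrightarrow> i \<le> j \<Longrightarrow> x j - z i \<le> h i j"
    and "\<And>i j. (i, j) \<in> F \<Longrightarrow> x j - z i = h i j"
proof -
  have F: "forest I J F" and long: "(Min I, Max J) \<in> F"
    using covering_forestD[OF cov] by auto
  have F_adm: "F \<subseteq> admissible" using forestD[OF F] by (auto simp: admissible_def)
  \<comment> \<open>\<open>X j\<close> and \<open>Z i\<close> collect the walks from
    \<open>Min I\<close> to the right node \<open>j\<close> and to the left node \<open>i\<close>.
    The multiset equations are flow balances: every node is left as often as it is entered, apart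
    from start and target.\<close>
  define X where "X j = {(M, N). set_mset N \<subseteq> F \<and> set_mset M \<subseteq> admissible \<and>
      image_mset fst M = add_mset (Min I) (image_mset fst N) \<and>
      image_mset snd M = add_mset j (image_mset snd N)}" for j
  define Z where "Z i = {(M, N). set_mset N \<subseteq> F \<and> set_mset M \<subseteq> admissible \<and>
      add_mset i (image_mset fst M) = add_mset (Min I) (image_mset fst N) \<and>
      image_mset snd M = image_mset snd N}" for i
  define d where "d = (\<lambda>(M, N). total M - total N)"
  have short: "(Min I, j) \<in> admissible" if "j \<in> J" for j
    using that Min_I le_J by (simp add: admissible_def)
  have long': "(i, Max J) \<in> admissible" if "i \<in> I" for i
    using that Max_J I_le by (simp add: admissible_def)
  have X_ne: "X j \<noteq> {}" if "j \<in> J" for j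
  proof -
    have "({#(Min I, j)#}, {#}) \<in> X j" using short[OF that] by (simp add: X_def)
    then show ?thesis by blast
  qed
  have Z_ne: "Z i \<noteq> {}" if i: "i \<in> I" for i
  proof -
    obtain j where "(i, j) \<in> F" using covering_arc_I[OF cov i] .
    then have "({#(Min I, j)#}, {#(i, j)#}) \<in> Z i"
      using short[OF forestD(2)[OF F]] by (simp add: Z_def add_mset_commute)
    then show ?thesis by blast
  qed
  have X_bdd: "bdd_below (d ` X j)" if j: "j \<in> J" for j
  proof -
    obtain i where i: "(i, j) \<in> F" using covering_arc_J[OF cov j] .
    \<comment> \<open>Returning from \<open>j\<close> through \<open>i\<close> and
      \<open>Max J\<close> to \<open>Min I\<close> gives a closed walk, whose cost is nonnegative by
      optimality of \<open>F\<close>.\<close>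
    have "h i j + h (Min I) (Max J) - h i (Max J) \<le> d p" if "p \<in> X j" for p
    proof -
      obtain M N where p: "p = (M, N)" by force
      have "total (add_mset (i, j) (add_mset (Min I, Max J) N)) \<le> total (add_mset (i, Max J) M)"
        by (rule forest_total_le[OF F])
          (use that i long long' forestD(1)[OF F i] in \<open>auto simp: X_def p add_mset_commute\<close>)
      then show ?thesis by (simp add: p d_def)
    qed
    then show ?thesis by (intro bdd_belowI2) auto
  qed
  have Z_bdd: "bdd_below (d ` Z i)" if "i \<in> I" for i
  proof -
    have "h (Min I) (Max J) - h i (Max J) \<le> d p" if "p \<in> Z i" for p
    proof -
      obtain M N where p: "p = (M, N)" by force
      have "total (add_mset (Min I, Max J) N) \<le> total (add_mset (i, Max J) M)"
        by (rule forest_total_le[OF F])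
          (use that long long' \<open>i \<in> I\<close> in \<open>auto simp: Z_def p\<close>)
      then show ?thesis by (simp add: p d_def)
    qed
    then show ?thesis by (intro bdd_belowI2) auto
  qed
  define x where "x j = Inf (d ` X j)" for j
  define z where "z i = Inf (d ` Z i)" for i
  \<comment> \<open>Appending the forward step \<open>(i, j)\<close> to a walk ending at
    \<open>i\<close> gives a walk ending at \<open>j\<close>; for arcs of \<open>F\<close> the
    reversed step below leads back.\<close>
  have le: "x j - h i j \<le> z i" if "i \<in> I" "j \<in> J" "i \<le> j" for i j
    unfolding z_def
  proof (rule cINF_greatest[OF Z_ne[OF that(1)]])
    fix p assume p: "p \<in> Z i"
    obtain M N where MN: "p = (M, N)" by force
    have "(add_mset (i, j) M, N) \<in> X j" using p that by (auto simp: X_def Z_def MN admissible_def)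
    then have "x j \<le> d (add_mset (i, j) M, N)"
      unfolding x_def by (rule cINF_lower[OF X_bdd[OF that(2)]])
    then show "x j - h i j \<le> d p" by (simp add: d_def MN)
  qed
  have ge: "z i + h i j \<le> x j" if ij: "(i, j) \<in> F" for i j
    unfolding x_def
  proof (rule cINF_greatest[OF X_ne[OF forestD(2)[OF F ij]]])
    fix p assume p: "p \<in> X j"
    obtain M N where MN: "p = (M, N)" by force
    have "(M, add_mset (i, j) N) \<in> Z i"
      using p ij by (auto simp: X_def Z_def MN add_mset_commute)
    then have "z i \<le> d (M, add_mset (i, j) N)"
      unfolding z_def by (rule cINF_lower[OF Z_bdd[OF forestD(1)[OF F ij]]])
    then show "z i + h i j \<le> d p" by (simp add: d_def MN)
  qed
  show thesis
  proof (rule that[of x z])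
    show "x j - z i \<le> h i j" if "i \<in> I" "j \<in> J" "i \<le> j" for i j
      using le[OF that] by simp
    show "x j - z i = h i j" if "(i, j) \<in> F" for i j
      using le[OF forestD[OF F that]] ge[OF that] by simp
  qed
qed

text \<open>Lowering the heights off \<open>F\<close> by a small \<open>\<epsilon>\<close> preserves the crossing inequalities, so that the
  potentials for the lowered heights are strict off \<open>F\<close> for the original ones.\<close>

lemma strict_potential_exists:
  assumes cov: "covering_forest I J F"
  obtains x z :: "nat \<Rightarrow> real"
  where "\<And>i j. i \<in> I \<Longrightarrow> j \<in> J \<Longrightarrow> i \<le> j \<Longrightarrow> (i, j) \<notin> F \<Longrightarrow> x j - z i < h i j"
    and "\<And>i j. (i, j) \<in> F \<Longrightarrow> x j - z i = h i j"
proof -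
  define Q where "Q = {(i, i', j, j'). i \<in> I \<and> i' \<in> I \<and> j \<in> J \<and> j' \<in> J \<and> i < i' \<and> i' \<le> j \<and> j < j'}"
  define gap where "gap = (\<lambda>(i, i', j, j'). h i j + h i' j' - h i j' - h i' j)"
  have "Q \<subseteq> I \<times> I \<times> J \<times> J" by (auto simp: Q_def)
  then have finQ: "finite Q" using finI finJ finite_subset by blast
  have pos: "0 < gap q" if "q \<in> Q" for q
    using that monge by (force simp: Q_def gap_def)
  \<comment> \<open>Lowering spoils each crossing inequality by at most
    \<open>2 * \<epsilon>\<close>, so a third of the least gap is safe; the inserted 1 keeps the
    minimum defined and positive when \<open>Q\<close> is empty.\<close>
  define \<epsilon> where "\<epsilon> = Min (insert 1 (gap ` Q)) / 3"
  have "Min (insert 1 (gap ` Q)) \<in> insert 1 (gap ` Q)" using finQ by (intro Min_in) auto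
  then have \<epsilon>: "0 < \<epsilon>" unfolding \<epsilon>_def using pos by fastforce
  have gap: "2 * \<epsilon> < gap q" if "q \<in> Q" for q
  proof -
    have "Min (insert 1 (gap ` Q)) \<le> gap q" using that finQ by (intro Min_le) auto
    then show ?thesis using \<epsilon> unfolding \<epsilon>_def by linarith
  qed
  define h' where "h' i j = h i j - (if (i, j) \<in> F then 0 else \<epsilon>)" for i j
  interpret lowered: strict_monge I J h'
  proof
    fix i i' j j' assume "i \<in> I" "i' \<in> I" "j \<in> J" "j' \<in> J" "i < i'" "i' \<le> j" "j < j'"
    then have "2 * \<epsilon> < gap (i, i', j, j')" by (intro gap) (simp add: Q_def)
    then show "h' i j' + h' i' j < h' i j + h' i' j'"
      using \<epsilon> by (simp add: h'_def gap_def)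
  qed
  obtain x z where "\<And>i j. i \<in> I \<Longrightarrow> j \<in> J \<Longrightarrow> i \<le> j \<Longrightarrow> x j - z i \<le> h' i j"
    and "\<And>i j. (i, j) \<in> F \<Longrightarrow> x j - z i = h' i j"
    using lowered.potential_exists[OF cov] by blast
  then show thesis
    using \<epsilon> by (intro that[of x z]) (force simp: h'_def)+
qed

end

section \<open>Cells of the arrangement\<close>

locale arrangement = strict_monge I J h for I J :: "nat set" and h :: "nat \<Rightarrow> nat \<Rightarrow> real" +
  fixes e :: "'n::finite \<Rightarrow> nat"
  assumes bij: "bij_betw e UNIV J"
begin

text \<open>Coordinates labelled by right nodes instead of by the index type; meaningful for
  \<open>j\<close> in \<open>J\<close> only, where \<open>e\<close> can be inverted.\<close>

definition crd :: "real ^ 'n \<Rightarrow> nat \<Rightarrow> real" where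
  "crd x j = x $ inv e j"

lemma crd_e [simp]: "crd x (e k) = x $ k"
  using bij by (simp add: crd_def bij_betw_def)

lemma crd_linear [simp]:
  "crd (x + y) j = crd x j + crd y j" "crd (x - y) j = crd x j - crd y j"
  "crd (c *\<^sub>R x) j = c * crd x j" "crd 0 j = 0"
  by (simp_all add: crd_def)

lemma e_in: "e k \<in> J"
  using bij by (auto simp: bij_betw_def)

lemma J_E: assumes "j \<in> J" obtains k where "j = e k"
  using assms bij by (auto simp: bij_betw_def)

lemma ex_crd: "\<exists>x. \<forall>j\<in>J. crd x j = f j"
proof (intro exI ballI)
  fix j assume "j \<in> J"
  then obtain k where "j = e k" by (rule J_E)
  then show "crd (\<chi> k. f (e k)) j = f j" by simp
qed

lemma continuous_crd [continuous_intros]: "continuous_on S (\<lambda>x. crd x j)"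
  unfolding crd_def by (intro continuous_intros)

lemma slice_iff: "x \<in> slice e \<longleftrightarrow> crd x (Max J) = 0"
proof -
  have J: "range e = J" using bij by (simp add: bij_betw_def)
  obtain k where "Max J = e k" using J_E[OF Max_J] .
  then show ?thesis
    unfolding slice_def J using crd_e bij by (auto simp: bij_betw_def inj_eq)
qed

text \<open>Infinite heights give values minus infinity, which never attain the maximum because
  \<open>Max J\<close> is at least \<open>i\<close> and gives a finite value.\<close>

lemma mem_maximizers:
  assumes i: "i \<in> I"
  shows "k \<in> maximizers e h i x \<longleftrightarrow>
    i \<le> e k \<and> (\<forall>l\<in>J. i \<le> l \<longrightarrow> crd x l - h i l \<le> crd x (e k) - h i (e k))"
proof -
  define f where "f l = ereal (x $ l) - height h i (e l)" for l
  have f: "f l = (if i \<le> e l then ereal (x $ l - h i (e l)) else - \<infinity>)" for l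
    by (simp add: f_def height_def)
  have "k \<in> maximizers e h i x \<longleftrightarrow> f k = Max (range f)"
    by (simp add: maximizers_def f_def)
  also have "\<dots> \<longleftrightarrow> (\<forall>l. f l \<le> f k)"
  proof
    assume "f k = Max (range f)"
    then show "\<forall>l. f l \<le> f k" by simp
  next
    assume "\<forall>l. f l \<le> f k"
    then show "f k = Max (range f)" by (intro Max_eqI[symmetric]) auto
  qed
  also have "\<dots> \<longleftrightarrow> i \<le> e k \<and> (\<forall>l. i \<le> e l \<longrightarrow> x $ l - h i (e l) \<le> x $ k - h i (e k))"
  proof -
    obtain m where "Max J = e m" using J_E[OF Max_J] .
    then have "i \<le> e m" using I_le[OF i] by simp
    then have "i \<le> e k" if "\<forall>l. f l \<le> f k"
      using that[rule_format, of m] by (simp add: f split: if_splits)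
    moreover have "f l \<le> f k \<longleftrightarrow> (i \<le> e l \<longrightarrow> x $ l - h i (e l) \<le> x $ k - h i (e k))" if "i \<le> e k" for l
      using that by (simp add: f)
    ultimately show ?thesis by blast
  qed
  also have "(\<forall>l. i \<le> e l \<longrightarrow> x $ l - h i (e l) \<le> x $ k - h i (e k)) \<longleftrightarrow>
      (\<forall>l\<in>J. i \<le> l \<longrightarrow> crd x l - h i l \<le> crd x (e k) - h i (e k))"
    using bij by (auto simp: bij_betw_def)
  finally show ?thesis .
qed

text \<open>All records of a point gathered into one set of arcs, to be compared with
  forests.\<close>

definition contacts :: "real ^ 'n \<Rightarrow> arc set" where
  "contacts x = {(i, e k) |i k. i \<in> I \<and> k \<in> maximizers e h i x}"

lemma mem_contacts:
  "(i, j) \<in> contacts x \<longleftrightarrow> i \<in> I \<and> j \<in> J \<and> i \<le> j \<and>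
     (\<forall>l\<in>J. i \<le> l \<longrightarrow> crd x l - h i l \<le> crd x j - h i j)"
proof (cases "i \<in> I \<and> j \<in> J")
  case True
  then obtain k where k: "j = e k" using J_E by blast
  then have "(i, j) \<in> contacts x \<longleftrightarrow> k \<in> maximizers e h i x"
    using True bij by (auto simp: contacts_def bij_betw_def inj_eq)
  then show ?thesis using mem_maximizers[of i k x] True k by blast
qed (use e_in in \<open>auto simp: contacts_def\<close>)

lemma contacts_eq_iff: "contacts x = contacts y \<longleftrightarrow> (\<forall>i\<in>I. maximizers e h i x = maximizers e h i y)"
proof
  assume eq: "contacts x = contacts y"
  show "\<forall>i\<in>I. maximizers e h i x = maximizers e h i y"
  proof (intro ballI set_eqI)
    fix i k assume "i \<in> I"
    then have "k \<in> maximizers e h i x \<longleftrightarrow> (i, e k) \<in> contacts x" for x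
      using mem_maximizers e_in by (simp add: mem_contacts)
    then show "k \<in> maximizers e h i x \<longleftrightarrow> k \<in> maximizers e h i y" using eq by simp
  qed
qed (auto simp: contacts_def)

text \<open>For a crossing pair, \<open>i' \<le> j\<close> makes all four arcs between the ends
  admissible, so each left node may be tested at the right end chosen by the other; the two
  inequalities together contradict \<open>monge\<close>.\<close>

lemma contacts_forest: "forest I J (contacts x)"
  unfolding forest_iff
proof (intro conjI allI impI)
  show "contacts x \<subseteq> I \<times> J" by (auto simp: mem_contacts)
  show "i \<le> j" if "(i, j) \<in> contacts x" for i j
    using that by (simp add: mem_contacts)
  show "j' \<le> j" if a: "(i, j) \<in> contacts x" "(i', j') \<in> contacts x" "i < i'" "i' \<le> j" for i j i' j'
  proof (rule ccontr)
    assume "\<not> j' \<le> j"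
    then have "h i j' + h i' j < h i j + h i' j'"
      using a by (intro monge) (auto simp: mem_contacts)
    moreover have "crd x j' - h i j' \<le> crd x j - h i j" "crd x j - h i' j \<le> crd x j' - h i' j'"
      using a \<open>\<not> j' \<le> j\<close> by (auto simp: mem_contacts)
    ultimately show False by simp
  qed
qed

lemma contacts_covers_I:
  assumes "i \<in> I"
  obtains j where "(i, j) \<in> contacts x"
proof -
  define V where "V = (\<lambda>j. crd x j - h i j) ` {j \<in> J. i \<le> j}"
  have "finite V" "V \<noteq> {}"
    using finJ Max_J I_le[OF assms] by (auto simp: V_def)
  define m where "m = Max V"
  have "m \<in> V" using \<open>finite V\<close> \<open>V \<noteq> {}\<close> by (simp add: m_def)
  then obtain j where "j \<in> J" "i \<le> j" "crd x j - h i j = m"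
    by (auto simp: V_def)
  moreover have "crd x l - h i l \<le> m" if "l \<in> J" "i \<le> l" for l
    unfolding m_def using \<open>finite V\<close> that by (intro Max_ge) (auto simp: V_def)
  ultimately have "(i, j) \<in> contacts x" using assms by (simp add: mem_contacts)
  then show thesis by (rule that)
qed

lemma contacts_gap:
  assumes "(i, j) \<in> contacts x" "l \<in> J" "i \<le> l" "(i, l) \<notin> contacts x"
  shows "crd x l - h i l < crd x j - h i j"
  using assms unfolding mem_contacts by force

lemma contacts_eqD:
  assumes "(i, j) \<in> contacts x" "(i, l) \<in> contacts x"
  shows "crd x l - h i l = crd x j - h i j"
  using assms unfolding mem_contacts by (meson order_antisym)

lemma contacts_eqI:
  assumes "(i, j) \<in> contacts x" "l \<in> J" "i \<le> l" "crd x l - h i l = crd x j - h i j"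
  shows "(i, l) \<in> contacts x"
  using assms unfolding mem_contacts by simp

text \<open>The potential \<open>z i\<close> is the value of the maximum for \<open>i\<close>,
  attained exactly on the arcs of \<open>F\<close>. Subtracting \<open>p (Max J)\<close> from all
  coordinates moves the point into the slice and changes no comparison.\<close>

lemma covering_contacts:
  assumes cov: "covering_forest I J F"
  obtains x where "x \<in> slice e" "contacts x = F"
proof -
  have F: "forest I J F" using covering_forestD(1)[OF cov] .
  obtain p z where less: "\<And>i j. i \<in> I \<Longrightarrow> j \<in> J \<Longrightarrow> i \<le> j \<Longrightarrow> (i, j) \<notin> F \<Longrightarrow> p j - z i < h i j"
    and eq: "\<And>i j. (i, j) \<in> F \<Longrightarrow> p j - z i = h i j"
    using strict_potential_exists[OF cov] by blast
  obtain x where x: "\<And>j. j \<in> J \<Longrightarrow> crd x j = p j - p (Max J)"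
    using ex_crd[of "\<lambda>j. p j - p (Max J)"] by blast
  show thesis
  proof (rule that)
    show "x \<in> slice e" using x Max_J by (simp add: slice_iff)
    have "(i, j) \<in> contacts x \<longleftrightarrow> (i, j) \<in> F" for i j
    proof
      assume "(i, j) \<in> F"
      moreover have "p l - h i l \<le> p j - h i j" if "l \<in> J" "i \<le> l" for l
        using less[of i l] eq[of i l] eq[OF \<open>(i, j) \<in> F\<close>] forestD(1)[OF F \<open>(i, j) \<in> F\<close>] that
        by (cases "(i, l) \<in> F") auto
      ultimately show "(i, j) \<in> contacts x"
        using forestD[OF F] x by (auto simp: mem_contacts)
    next
      assume r: "(i, j) \<in> contacts x"
      then have ij: "i \<in> I" "j \<in> J" "i \<le> j" by (auto simp: mem_contacts)
      obtain k where k: "(i, k) \<in> F" using covering_arc_I[OF cov ij(1)] .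
      then have "crd x k - h i k \<le> crd x j - h i j"
        using r forestD[OF F k] by (simp add: mem_contacts)
      then have "h i j \<le> p j - z i" using x ij forestD[OF F k] eq[OF k] by simp
      then show "(i, j) \<in> F" using less[OF ij] by fastforce
    qed
    then show "contacts x = F" by auto
  qed
qed

text \<open>Equality of records relaxed to inclusion, which makes the condition closed; for a record
  \<open>F\<close> this is the closure of its class.\<close>

definition cell :: "arc set \<Rightarrow> (real ^ 'n) set" where
  "cell F = {x \<in> slice e. F \<subseteq> contacts x}"

lemma cell_eq:
  assumes "F \<subseteq> admissible"
  shows "cell F = {x. crd x (Max J) = 0} \<inter>
    (\<Inter>(i, j)\<in>F. \<Inter>l\<in>{l \<in> J. i \<le> l}. {x. crd x l - h i l \<le> crd x j - h i j})"
  using assms by (auto simp: cell_def slice_iff mem_contacts admissible_def subset_iff)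

lemma contacts_admissible: "contacts x \<subseteq> admissible"
  by (auto simp: mem_contacts admissible_def)

lemma closed_cell: "F \<subseteq> admissible \<Longrightarrow> closed (cell F)"
  by (auto simp: cell_eq case_prod_beta
      intro!: closed_Int closed_INT closed_Collect_eq closed_Collect_le continuous_intros)

text \<open>Along the segment each comparison is a convex combination of those at its ends. Arcs of
  \<open>F\<close> are contacts at both ends, while any other arc falls strictly short at
  \<open>x\<close>, which has positive weight \<open>t\<close>.\<close>

lemma contacts_segment:
  assumes x: "contacts x = F" and y: "F \<subseteq> contacts y" and t: "0 < t" "t \<le> 1"
  shows "contacts (y + t *\<^sub>R (x - y)) = F"
proof -
  define w where "w = y + t *\<^sub>R (x - y)"
  have w: "crd w l - h i l = (1 - t) * (crd y l - h i l) + t * (crd x l - h i l)" for i l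
    by (simp add: w_def algebra_simps)
  have "(i, j) \<in> contacts w \<longleftrightarrow> (i, j) \<in> contacts x" for i j
  proof
    assume ij: "(i, j) \<in> contacts x"
    then have "(i, j) \<in> contacts y" using x y by blast
    then have "crd w l - h i l \<le> crd w j - h i j" if "l \<in> J" "i \<le> l" for l
      unfolding w using ij that t
      by (intro add_mono mult_left_mono) (auto simp: mem_contacts)
    then show "(i, j) \<in> contacts w" using ij by (simp add: mem_contacts)
  next
    assume ij: "(i, j) \<in> contacts w"
    then have adm: "i \<in> I" "j \<in> J" "i \<le> j" by (auto simp: mem_contacts)
    obtain k where k: "(i, k) \<in> contacts x" using contacts_covers_I[OF adm(1)] .
    show "(i, j) \<in> contacts x"
    proof (rule ccontr)
      assume "(i, j) \<notin> contacts x"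
      then have "t * (crd x j - h i j) < t * (crd x k - h i k)"
        using contacts_gap[OF k adm(2,3)] t by simp
      moreover have "(1 - t) * (crd y j - h i j) \<le> (1 - t) * (crd y k - h i k)"
        using k x y t adm by (intro mult_left_mono) (auto simp: mem_contacts)
      moreover have "crd w k - h i k \<le> crd w j - h i j"
        using ij k by (simp add: mem_contacts)
      ultimately show False unfolding w by linarith
    qed
  qed
  then show ?thesis using x unfolding w_def by auto
qed

lemma slice_linear:
  "x \<in> slice e \<Longrightarrow> y \<in> slice e \<Longrightarrow> x + y \<in> slice e"
  "x \<in> slice e \<Longrightarrow> y \<in> slice e \<Longrightarrow> x - y \<in> slice e"
  "x \<in> slice e \<Longrightarrow> c *\<^sub>R x \<in> slice e"
  by (simp_all add: slice_iff)

text \<open>Every \<open>y\<close> in the cell is approached along the segment from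
  \<open>x\<close>, whose points other than \<open>y\<close> have the record of
  \<open>x\<close>.\<close>

lemma closure_contacts_class:
  assumes x: "x \<in> slice e"
  shows "closure {y \<in> slice e. contacts y = contacts x} = cell (contacts x)"
proof
  show "closure {y \<in> slice e. contacts y = contacts x} \<subseteq> cell (contacts x)"
    by (rule closure_minimal[OF _ closed_cell[OF contacts_admissible]]) (auto simp: cell_def)
  show "cell (contacts x) \<subseteq> closure {y \<in> slice e. contacts y = contacts x}"
  proof
    fix y assume y: "y \<in> cell (contacts x)"
    define f where "f n = y + inverse (real (Suc n)) *\<^sub>R (x - y)" for n
    have "f n \<in> {y \<in> slice e. contacts y = contacts x}" for n
      using y x contacts_segment[OF refl, of x y "inverse (real (Suc n))"] slice_linear
      by (simp add: f_def cell_def inverse_le_1_iff)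
    moreover have "f \<longlonglongrightarrow> y + 0 *\<^sub>R (x - y)"
      unfolding f_def by (intro tendsto_intros LIMSEQ_inverse_real_of_nat)
    ultimately show "y \<in> closure {y \<in> slice e. contacts y = contacts x}"
      unfolding closure_sequential by (intro exI[of _ f]) simp
  qed
qed

lemma cells_eq: "cells I e h = (\<lambda>x. cell (contacts x)) ` slice e"
  unfolding cells_def using closure_contacts_class
  by (intro image_cong) (simp_all add: contacts_eq_iff)

lemma cell_antimono: "G \<subseteq> F \<Longrightarrow> cell F \<subseteq> cell G"
  by (auto simp: cell_def)

lemma cell_subset_iff:
  assumes "covering_forest I J F"
  shows "cell F \<subseteq> cell G \<longleftrightarrow> G \<subseteq> F"
proof
  obtain x where x: "x \<in> slice e" "contacts x = F" using covering_contacts[OF assms] .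
  assume "cell F \<subseteq> cell G"
  then have "x \<in> cell G" using x by (auto simp: cell_def)
  then show "G \<subseteq> F" using x by (simp add: cell_def)
qed (rule cell_antimono)

text \<open>The coordinate at \<open>Max J\<close> is 0. The long arc bounds every coordinate from
  above against it, and an arc ending at \<open>e k\<close> bounds the coordinate at
  \<open>k\<close> from below; each comparison costs two heights.\<close>

lemma covering_bounded:
  assumes cov: "covering_forest I J F"
  shows "bounded (cell F)"
proof -
  have F: "forest I J F" and long: "(Min I, Max J) \<in> F"
    using covering_forestD[OF cov] by auto
  define B where "B = Max (insert 0 ((\<lambda>(i, j). \<bar>h i j\<bar>) ` (I \<times> J)))"
  have B: "\<bar>h i j\<bar> \<le> B" if "i \<in> I" "j \<in> J" for i j
    unfolding B_def using that finI finJ by (intro Max_ge) auto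
  have "\<bar>x $ k\<bar> \<le> 2 * B" if x: "x \<in> cell F" for x k
  proof -
    have zero: "crd x (Max J) = 0" using x by (simp add: cell_def slice_iff)
    have "(Min I, Max J) \<in> contacts x" using x long by (auto simp: cell_def)
    then have "crd x (e k) - h (Min I) (e k) \<le> crd x (Max J) - h (Min I) (Max J)"
      using e_in[of k] le_J unfolding mem_contacts by blast
    then have 1: "x $ k \<le> 2 * B"
      using B[OF Min_I e_in[of k]] B[OF Min_I Max_J] zero by simp
    obtain i where i: "(i, e k) \<in> F" using covering_arc_J[OF cov e_in] .
    then have "(i, e k) \<in> contacts x" using x by (auto simp: cell_def)
    then have "crd x (Max J) - h i (Max J) \<le> crd x (e k) - h i (e k)"
      using I_le Max_J unfolding mem_contacts by blast
    then have 2: "- x $ k \<le> 2 * B"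
      using B[OF forestD(1)[OF F i] e_in[of k]] B[OF forestD(1)[OF F i] Max_J] zero by simp
    show ?thesis using 1 2 by simp
  qed
  then show ?thesis
    by (intro bounded_subset[OF bounded_cbox[of "\<chi> k. - 2 * B" "\<chi> k. 2 * B"]])
      (auto simp: mem_box_cart abs_le_iff minus_le_iff)
qed

text \<open>\<open>dir\<close> puts \<open>v\<close> in the recession cone: moving along
  \<open>v\<close> never favours a competitor over an arc of \<open>F\<close>.\<close>

lemma unbounded_direction:
  assumes x: "x \<in> cell F" and v: "v \<in> slice e" "v \<noteq> 0"
    and dir: "\<And>i j l. (i, j) \<in> F \<Longrightarrow> l \<in> J \<Longrightarrow> i \<le> l \<Longrightarrow> crd v l \<le> crd v j"
  shows "\<not> bounded (cell F)"
proof
  assume "bounded (cell F)"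
  then obtain B where B: "\<And>y. y \<in> cell F \<Longrightarrow> norm y \<le> B" by (auto simp: bounded_iff)
  have "norm (x + t *\<^sub>R v) \<le> B" if "0 \<le> t" for t
  proof (rule B)
    have "(i, j) \<in> contacts (x + t *\<^sub>R v)" if ij: "(i, j) \<in> F" for i j
    proof -
      have "(i, j) \<in> contacts x" using x ij by (auto simp: cell_def)
      moreover have "t * crd v l \<le> t * crd v j" if "l \<in> J" "i \<le> l" for l
        using dir[OF ij that] \<open>0 \<le> t\<close> by (rule mult_left_mono)
      ultimately show ?thesis by (fastforce simp: mem_contacts)
    qed
    then show "x + t *\<^sub>R v \<in> cell F"
      using x v slice_linear by (auto simp: cell_def)
  qed
  moreover define t where "t = (\<bar>B\<bar> + norm x + 1) / norm v"
  moreover have "0 \<le> t" using v by (simp add: t_def)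
  ultimately have "norm (x + t *\<^sub>R v) \<le> B" by blast
  moreover have "norm (t *\<^sub>R v) \<le> norm (x + t *\<^sub>R v) + norm x"
    using norm_triangle_ineq4[of "x + t *\<^sub>R v" x] by simp
  moreover have "norm (t *\<^sub>R v) = \<bar>B\<bar> + norm x + 1"
    using v \<open>0 \<le> t\<close> by (simp add: t_def)
  ultimately show False by simp
qed

text \<open>If \<open>Min I\<close> and \<open>Max J\<close> are not joined, the recession direction is the indicator of the
  indices up to the longest arc at \<open>Min I\<close>; if \<open>bar j\<close> is isolated, it is the negative \<open>j\<close>-axis.\<close>

lemma bounded_covering:
  assumes x: "x \<in> slice e" and bdd: "bounded (cell (contacts x))"
  shows "covering_forest I J (contacts x)"
proof -
  have mem: "x \<in> cell (contacts x)" using x by (simp add: cell_def)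
  have long: "(Min I, Max J) \<in> contacts x"
  proof (rule ccontr)
    assume no: "(Min I, Max J) \<notin> contacts x"
    have fin: "finite (contacts x)" using finite_forest[OF finI finJ contacts_forest] .
    obtain b where "(Min I, b) \<in> contacts x" using contacts_covers_I[OF Min_I] .
    then have a: "(Min I, longest_arc (contacts x) (Min I)) \<in> contacts x"
      and a_max: "\<And>b. (Min I, b) \<in> contacts x \<Longrightarrow> b \<le> longest_arc (contacts x) (Min I)"
      using longest_arc_in[OF fin] by blast+
    define a where "a = longest_arc (contacts x) (Min I)"
    note a = a[folded a_def] and a_max = a_max[folded a_def]
    have "a \<in> J" using a by (simp add: mem_contacts)
    then have "a < Max J" using J_le[of a] a no by (cases "a = Max J") auto
    obtain v where v: "\<And>j. j \<in> J \<Longrightarrow> crd v j = (if j \<le> a then 1 else 0)"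
      using ex_crd[of "\<lambda>j. if j \<le> a then 1 else 0"] by blast
    have "\<not> bounded (cell (contacts x))"
    proof (rule unbounded_direction[OF mem])
      show "v \<in> slice e" using v[OF Max_J] \<open>a < Max J\<close> by (simp add: slice_iff)
      show "v \<noteq> 0" using v[OF \<open>a \<in> J\<close>] by auto
      show "crd v l \<le> crd v j" if ij: "(i, j) \<in> contacts x" and l: "l \<in> J" "i \<le> l" for i j l
      \<comment> \<open>An arc ending beyond \<open>a\<close> must also start beyond
        \<open>a\<close>, or it would cross the longest arc at \<open>Min I\<close>; so all its
        competitors \<open>l\<close> lie beyond \<open>a\<close> and have value 0 as well.\<close>
      proof (cases "j \<le> a")
        case False
        have "i \<in> I" "j \<in> J" using ij by (auto simp: mem_contacts)
        moreover have "i \<noteq> Min I" using a_max ij False by blast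
        ultimately have "Min I < i" using le_I[of i] by simp
        then have "\<not> i \<le> a"
          using forest_noncrossing[OF contacts_forest a ij] False by blast
        then show ?thesis using v[OF l(1)] v[OF \<open>j \<in> J\<close>] l(2) False by simp
      qed (use v l ij in \<open>auto simp: mem_contacts\<close>)
    qed
    then show False using bdd by blast
  qed
  moreover have "\<exists>i. (i, j) \<in> contacts x" if j: "j \<in> J" for j
  proof (rule ccontr)
    assume no: "\<nexists>i. (i, j) \<in> contacts x"
    then have "j \<noteq> Max J" using long by blast
    obtain v where v: "\<And>l. l \<in> J \<Longrightarrow> crd v l = (if l = j then - 1 else 0)"
      using ex_crd[of "\<lambda>l. if l = j then - 1 else 0"] by blast
    have "\<not> bounded (cell (contacts x))"
    proof (rule unbounded_direction[OF mem])
      show "v \<in> slice e" using v[OF Max_J] \<open>j \<noteq> Max J\<close> by (simp add: slice_iff)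
      show "v \<noteq> 0" using v[OF j] by auto
      show "crd v l \<le> crd v k" if "(i, k) \<in> contacts x" "l \<in> J" for i k l
        using that v no by (auto simp: mem_contacts)
    qed
    then show False using bdd by blast
  qed
  ultimately show ?thesis
    unfolding covering_forest_def using contacts_forest contacts_covers_I by metis
qed

lemma Asso_eq: "Asso I e h = cell ` {F. covering_forest I J F}"
proof
  show "Asso I e h \<subseteq> cell ` {F. covering_forest I J F}"
    unfolding Asso_def cells_eq using bounded_covering by blast
  show "cell ` {F. covering_forest I J F} \<subseteq> Asso I e h"
  proof clarify
    fix F assume F: "covering_forest I J F"
    obtain x where "x \<in> slice e" "contacts x = F" using covering_contacts[OF F] .
    then show "cell F \<in> Asso I e h"
      unfolding Asso_def cells_eq using covering_bounded[OF F] by blast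
  qed
qed

text \<open>The solutions of the linear parts of the equations that arcs of \<open>F\<close> with a
  common left end impose on a point.\<close>

definition flat_direction :: "arc set \<Rightarrow> real ^ 'n \<Rightarrow> bool" where
  "flat_direction F v \<longleftrightarrow> v \<in> slice e \<and> (\<forall>i j k. (i, j) \<in> F \<longrightarrow> (i, k) \<in> F \<longrightarrow> crd v j = crd v k)"

lemma flat_direction_diff:
  assumes "x \<in> cell F" "y \<in> cell F"
  shows "flat_direction F (x - y)"
  unfolding flat_direction_def
proof (intro conjI allI impI)
  show "x - y \<in> slice e" using assms slice_linear by (simp add: cell_def)
  fix i j k assume "(i, j) \<in> F" "(i, k) \<in> F"
  then have "crd x k - h i k = crd x j - h i j" "crd y k - h i k = crd y j - h i j"
    using assms by (auto intro!: contacts_eqD simp: cell_def)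
  then show "crd (x - y) j = crd (x - y) k" by simp
qed

text \<open>Only the finitely many comparisons in \<open>Q\<close> matter. Tight ones stay tight
  because \<open>v\<close> is flat, strict ones survive small steps, and finiteness gives a common
  step.\<close>

lemma contacts_perturb:
  assumes v: "flat_direction (contacts y) v"
  shows "\<exists>\<delta>>0. contacts y \<subseteq> contacts (y + \<delta> *\<^sub>R v)"
proof -
  define P where "P = (\<lambda>\<delta> ((i, j), l). crd y l - h i l + \<delta> * crd v l \<le> crd y j - h i j + \<delta> * crd v j)"
  define Q where "Q = {((i, j), l). (i, j) \<in> contacts y \<and> l \<in> J \<and> i \<le> l}"
  have "Q \<subseteq> contacts y \<times> J" by (auto simp: Q_def)
  then have finQ: "finite Q"
    using finite_forest[OF finI finJ contacts_forest] finJ finite_subset by blast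
  have "\<forall>\<^sub>F \<delta> in at_right 0. P \<delta> q" if q: "q \<in> Q" for q
  proof -
    obtain i j l where q_eq: "q = ((i, j), l)" by (metis prod.exhaust)
    have ij: "(i, j) \<in> contacts y" and l: "l \<in> J" "i \<le> l" using q by (auto simp: Q_def q_eq)
    show ?thesis
    proof (cases "(i, l) \<in> contacts y")
      case True
      then have "crd v l = crd v j" using v ij unfolding flat_direction_def by blast
      then have "P \<delta> q" for \<delta>
        using contacts_eqD[OF ij True] by (simp add: P_def q_eq)
      then show ?thesis by simp
    next
      case False
      have "((\<lambda>\<delta>. crd y j - h i j + \<delta> * crd v j - (crd y l - h i l + \<delta> * crd v l)) \<longlongrightarrow>
          crd y j - h i j + 0 * crd v j - (crd y l - h i l + 0 * crd v l)) (at_right 0)"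
        by (intro tendsto_intros)
      moreover have "0 < crd y j - h i j + 0 * crd v j - (crd y l - h i l + 0 * crd v l)"
        using contacts_gap[OF ij l False] by simp
      ultimately have "\<forall>\<^sub>F \<delta> in at_right 0.
          0 < crd y j - h i j + \<delta> * crd v j - (crd y l - h i l + \<delta> * crd v l)"
        by (rule order_tendstoD)
      then show ?thesis by eventually_elim (simp add: P_def q_eq)
    qed
  qed
  then have "\<forall>\<^sub>F \<delta> in at_right 0. \<forall>q\<in>Q. P \<delta> q"
    using finQ by (simp add: eventually_ball_finite)
  then have "\<forall>\<^sub>F \<delta> in at_right 0. 0 < \<delta> \<and> (\<forall>q\<in>Q. P \<delta> q)"
    using eventually_at_right_less[of "0 :: real"] by eventually_elim simp
  then obtain \<delta> :: real where \<delta>: "0 < \<delta>" "\<And>q. q \<in> Q \<Longrightarrow> P \<delta> q"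
    using eventually_happens'[OF trivial_limit_at_right_real] by blast
  have "(i, j) \<in> contacts (y + \<delta> *\<^sub>R v)" if ij: "(i, j) \<in> contacts y" for i j
  proof -
    have "crd y l - h i l + \<delta> * crd v l \<le> crd y j - h i j + \<delta> * crd v j" if "l \<in> J" "i \<le> l" for l
      using \<delta>(2)[of "((i, j), l)"] ij that by (simp add: Q_def P_def)
    then show ?thesis using ij by (fastforce simp: mem_contacts)
  qed
  then show ?thesis using \<delta>(1) by auto
qed

text \<open>Equalities between contacts persist along \<open>v\<close> and strict inequalities persist nearby, so the
  last point of the ray in the cell must have acquired a new contact.\<close>

lemma line_exit:
  assumes x: "x \<in> slice e" and bdd: "bounded (cell (contacts x))"
    and v: "flat_direction (contacts x) v" "v \<noteq> 0"
  obtains t where "0 < t" "contacts x \<subset> contacts (x + t *\<^sub>R v)"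
proof -
  define S where "S = {t. 0 \<le> t \<and> x + t *\<^sub>R v \<in> cell (contacts x)}"
  have "S = {0..} \<inter> (\<lambda>t. x + t *\<^sub>R v) -` cell (contacts x)" by (auto simp: S_def)
  moreover have "closed ((\<lambda>t. x + t *\<^sub>R v) -` cell (contacts x))"
    by (intro closed_vimage closed_cell contacts_admissible continuous_intros)
  ultimately have "closed S" by (simp add: closed_Int)
  obtain B where B: "\<And>y. y \<in> cell (contacts x) \<Longrightarrow> norm y \<le> B" using bdd by (auto simp: bounded_iff)
  have "t \<le> (B + norm x) / norm v" if "t \<in> S" for t
  proof -
    have "norm (t *\<^sub>R v) \<le> norm (x + t *\<^sub>R v) + norm x"
      using norm_triangle_ineq4[of "x + t *\<^sub>R v" x] by simp
    also have "\<dots> \<le> B + norm x" using B that by (simp add: S_def)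
    finally show ?thesis using that v by (simp add: S_def field_simps)
  qed
  then have "bdd_above S" by (rule bdd_aboveI)
  have "0 \<in> S" using x by (simp add: S_def cell_def)
  define t where "t = Sup S"
  have "t \<in> S"
    unfolding t_def using closed_contains_Sup[OF _ \<open>bdd_above S\<close> \<open>closed S\<close>] \<open>0 \<in> S\<close> by blast
  then have sub: "contacts x \<subseteq> contacts (x + t *\<^sub>R v)" and "0 \<le> t" by (auto simp: S_def cell_def)
  have ne: "contacts (x + t *\<^sub>R v) \<noteq> contacts x"
  proof
    assume eq: "contacts (x + t *\<^sub>R v) = contacts x"
    then obtain \<delta> where \<delta>: "\<delta> > 0" "contacts x \<subseteq> contacts (x + t *\<^sub>R v + \<delta> *\<^sub>R v)"
      using contacts_perturb[of "x + t *\<^sub>R v" v] v(1) by auto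
    have "x + (t + \<delta>) *\<^sub>R v \<in> slice e"
      using x v(1) slice_linear by (simp add: flat_direction_def)
    then have "t + \<delta> \<in> S"
      using \<delta> \<open>0 \<le> t\<close> by (simp add: S_def cell_def scaleR_add_left add.assoc)
    then have "t + \<delta> \<le> t" unfolding t_def by (intro cSup_upper \<open>bdd_above S\<close>)
    then show False using \<delta> by simp
  qed
  have "t \<noteq> 0" using ne by auto
  then show thesis using that[of t] sub ne \<open>0 \<le> t\<close> by auto
qed

text \<open>Leaving the cell in a nonzero flat direction would add an arc to a maximal
  forest.\<close>

lemma tree_flat_direction:
  assumes "tree I J T" "flat_direction T v"
  shows "v = 0"
proof (rule ccontr)
  assume "v \<noteq> 0"
  have cov: "covering_forest I J T" using tree_covering[OF assms(1)] .
  obtain x where x: "x \<in> slice e" "contacts x = T" using covering_contacts[OF cov] .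
  obtain t where "T \<subset> contacts (x + t *\<^sub>R v)"
    using line_exit[OF x(1), unfolded x(2), OF covering_bounded[OF cov] assms(2) \<open>v \<noteq> 0\<close>] by blast
  then show False using tree_eqI[OF assms(1) contacts_forest] by blast
qed

lemma tree_cell:
  assumes T: "tree I J T" and x: "x \<in> cell T"
  shows "cell T = {x}"
proof -
  have "y = x" if "y \<in> cell T" for y
    using tree_flat_direction[OF T flat_direction_diff[OF that x]] by simp
  then show ?thesis using x by blast
qed

text \<open>The ray from the point \<open>y\<close> of one tree through a point \<open>x\<close>
  with record \<open>R\<close> leaves the cell beyond \<open>x\<close>. The record gains an arc
  there, hence is a tree by counting, and it differs from \<open>T\<close> because the cell of
  \<open>T\<close> is only \<open>y\<close>, on the other side of \<open>x\<close>.\<close>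

lemma covering_two_trees:
  assumes cov: "covering_forest I J R" and card: "card R + 2 = card I + card J"
  shows "\<exists>T T'. tree I J T \<and> tree I J T' \<and> R \<subseteq> T \<and> R \<subseteq> T' \<and> T \<noteq> T'"
proof -
  have F: "forest I J R" using covering_forestD(1)[OF cov] .
  obtain x where x: "x \<in> slice e" "contacts x = R" using covering_contacts[OF cov] .
  obtain T where T: "tree I J T" "R \<subseteq> T" using ex_tree_superset[OF finI finJ F] .
  obtain y where y: "y \<in> slice e" "contacts y = T" using covering_contacts[OF tree_covering[OF T(1)]] .
  have "x \<noteq> y" using x y card tree_card[OF nodes_axioms T(1)] by auto
  have flat: "flat_direction R (x - y)"
    using x y T by (intro flat_direction_diff) (auto simp: cell_def)
  have "x - y \<noteq> 0" using \<open>x \<noteq> y\<close> by simp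
  then obtain t where t: "0 < t" "R \<subset> contacts (x + t *\<^sub>R (x - y))"
    using line_exit[OF x(1), unfolded x(2), OF covering_bounded[OF cov] flat] by blast
  define w where "w = x + t *\<^sub>R (x - y)"
  have "card R < card (contacts w)"
    using t finite_forest[OF finI finJ contacts_forest] by (auto simp: w_def intro: psubset_card_mono)
  then have W: "tree I J (contacts w)"
    using card forest_card_le[OF contacts_forest[of w]] contacts_forest by (simp add: tree_iff_card)
  have "contacts w \<noteq> T"
  proof
    assume "contacts w = T"
    then have "w \<in> cell T" using x y slice_linear by (simp add: w_def cell_def)
    moreover have "cell T = {y}" using y by (intro tree_cell[OF T(1)]) (simp add: cell_def)
    ultimately have "(1 + t) *\<^sub>R (x - y) = 0" by (simp add: w_def algebra_simps)
    then show False using \<open>x \<noteq> y\<close> t by simp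
  qed
  then show ?thesis using T W t unfolding w_def by blast
qed

lemma interior_faces_tamari: "interior_faces (tamari_complex I J) = {F. covering_forest I J F}"
  by (rule interior_faces_eq[OF covering_two_trees])

section \<open>Cells of dimension zero and one\<close>

lemma aff_dim_cell_0_iff:
  assumes cov: "covering_forest I J F"
  shows "aff_dim (cell F) = 0 \<longleftrightarrow> tree I J F"
proof
  obtain x where x: "x \<in> slice e" "contacts x = F" using covering_contacts[OF cov] .
  then have mem: "x \<in> cell F" by (simp add: cell_def)
  show "aff_dim (cell F) = 0" if "tree I J F"
    using tree_cell[OF that mem] by simp
  assume "aff_dim (cell F) = 0"
  then have sing: "cell F = {x}" using mem by (auto simp: aff_dim_eq_0)
  have "forest I J F" using covering_forestD(1)[OF cov] .
  \<comment> \<open>The point of any tree above \<open>F\<close> lies in the cell, hence is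
    \<open>x\<close>, so that tree is the record \<open>F\<close> of \<open>x\<close>.\<close>
  then obtain T where T: "tree I J T" "F \<subseteq> T" using ex_tree_superset[OF finI finJ] by blast
  obtain y where y: "y \<in> slice e" "contacts y = T" using covering_contacts[OF tree_covering[OF T(1)]] .
  then have "y \<in> cell F" using T by (simp add: cell_def)
  then show "tree I J F" using sing x y T by simp
qed

text \<open>\<open>R\<close> is one arc short of \<open>T\<close>, so a flat direction of
  \<open>R\<close> that also satisfies the equation of the missing arc is flat for \<open>T\<close>
  and vanishes. Hence the flat directions form a line, spanned by \<open>y - x\<close>.\<close>

lemma aff_dim_flip_cell:
  assumes "flip_related I J T T'"
  shows "aff_dim (cell (T \<inter> T')) = 1"
proof -
  define R where "R = T \<inter> T'"
  have card: "card R + 2 = card I + card J" and cov: "covering_forest I J R"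
    using flip_intersection[OF assms] by (auto simp: R_def)
  have T: "tree I J T" and "R \<subseteq> T" using assms by (auto simp: flip_related_def R_def)
  obtain x where x: "x \<in> slice e" "contacts x = R" using covering_contacts[OF cov] .
  obtain y where y: "y \<in> slice e" "contacts y = T" using covering_contacts[OF tree_covering[OF T]] .
  have mem: "x \<in> cell R" "y \<in> cell R" using x y \<open>R \<subseteq> T\<close> by (auto simp: cell_def)
  have "R \<noteq> T" using card tree_card[OF nodes_axioms T] by auto
  then have "x \<noteq> y" using x y by blast
  obtain i j where ij: "(i, j) \<in> T" "(i, j) \<notin> R" using \<open>R \<noteq> T\<close> \<open>R \<subseteq> T\<close> by auto
  have T_eq: "T = insert (i, j) R" using tree_eq_insert[OF T card \<open>R \<subseteq> T\<close> ij] .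
  have adm: "i \<in> I" "j \<in> J" "i \<le> j" using forestD[OF tree_forest[OF T] ij(1)] by auto
  obtain k where k: "(i, k) \<in> R" using covering_arc_I[OF cov adm(1)] .
  \<comment> \<open>The linear part of the equation that the missing arc \<open>(i, j)\<close>
    imposes relative to the arc \<open>(i, k)\<close>; the equation holds at \<open>y\<close> and
    fails at \<open>x\<close>.\<close>
  define g where "g v = crd v j - crd v k" for v
  have "g (y - x) \<noteq> 0"
  proof
    assume "g (y - x) = 0"
    moreover have "crd y j - h i j = crd y k - h i k"
      using contacts_eqD[of i k y j] ij k y(2) \<open>R \<subseteq> T\<close> by blast
    ultimately have "crd x j - h i j = crd x k - h i k" by (simp add: g_def)
    then have "(i, j) \<in> contacts x" using contacts_eqI[of i k x j] k x(2) adm by simp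
    then show False using ij x(2) by simp
  qed
  have "cell R \<subseteq> affine hull {x, y}"
  proof
    fix w assume w: "w \<in> cell R"
    \<comment> \<open>The multiple of \<open>y - x\<close> to be removed so that
      \<open>g u = 0\<close>.\<close>
    define s where "s = g (w - x) / g (y - x)"
    define u where "u = (w - x) - s *\<^sub>R (y - x)"
    have flat: "flat_direction R (w - x)" "flat_direction R (y - x)"
      using w mem flat_direction_diff by blast+
    have "flat_direction R u"
      unfolding flat_direction_def
    proof (intro conjI allI impI)
      show "u \<in> slice e"
        using flat unfolding u_def flat_direction_def by (blast intro: slice_linear)
      fix a b c assume "(a, b) \<in> R" "(a, c) \<in> R"
      then have "crd (w - x) b = crd (w - x) c" "crd (y - x) b = crd (y - x) c"
        using flat unfolding flat_direction_def by blast+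
      then show "crd u b = crd u c"
        unfolding u_def crd_linear(2)[of "w - x"] crd_linear(3) by simp
    qed
    moreover have "crd u j = crd u k"
    proof -
      have "g u = g (w - x) - s * g (y - x)" by (simp add: u_def g_def algebra_simps)
      then have "g u = 0" using \<open>g (y - x) \<noteq> 0\<close> by (simp add: s_def)
      then show ?thesis by (simp add: g_def)
    qed
    ultimately have "flat_direction T u"
      using k unfolding T_eq flat_direction_def by (metis insert_iff prod.inject)
    then have "u = 0" using tree_flat_direction[OF T] by blast
    then have "w = (1 - s) *\<^sub>R x + s *\<^sub>R y" by (simp add: u_def algebra_simps)
    then have "w = (1 - s) *\<^sub>R x + s *\<^sub>R y \<and> (1 - s) + s = 1" by simp
    then show "w \<in> affine hull {x, y}"
      unfolding affine_hull_2 by blast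
  qed
  then have "aff_dim (cell R) \<le> aff_dim {x, y}"
    using aff_dim_subset[of "cell R" "affine hull {x, y}"] by simp
  moreover have "aff_dim {x, y} \<le> aff_dim (cell R)"
    using mem by (intro aff_dim_subset) auto
  ultimately show ?thesis using \<open>x \<noteq> y\<close> by (simp add: aff_dim_2 R_def)
qed

text \<open>If at least two arcs were missing, a forest strictly between \<open>F\<close> and
  \<open>T\<close> would give a point \<open>y\<close> besides the point \<open>z\<close> of
  \<open>T\<close>. Both satisfy the equation of the added arc \<open>(i, j)\<close>, hence so does
  the line through them; in dimension 1 that line contains the point with record \<open>F\<close>, a
  contradiction.\<close>

lemma edge_cell_card:
  assumes cov: "covering_forest I J F" and dim: "aff_dim (cell F) = 1"
    and T: "tree I J T" "F \<subseteq> T"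
  shows "card F + 2 = card I + card J"
proof -
  have "\<not> tree I J F" using aff_dim_cell_0_iff[OF cov] dim by simp
  then have "F \<noteq> T" using T by blast
  then obtain i j where ij: "(i, j) \<in> T" "(i, j) \<notin> F" using T by auto
  have "insert (i, j) F = T"
  proof (rule ccontr)
    assume ne: "insert (i, j) F \<noteq> T"
    define G where "G = insert (i, j) F"
    have G: "F \<subseteq> G" "G \<subseteq> T" "G \<noteq> T" using ne ij T by (auto simp: G_def)
    have "covering_forest I J G"
      using covering_mono[OF cov G(1)] forest_subset[OF tree_forest[OF T(1)] G(2)] .
    then obtain y where y: "y \<in> slice e" "contacts y = G" by (rule covering_contacts)
    obtain z where z: "z \<in> slice e" "contacts z = T" using covering_contacts[OF tree_covering[OF T(1)]] .
    obtain x where x: "x \<in> slice e" "contacts x = F" using covering_contacts[OF cov] .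
    have "y \<noteq> z" using y z G by blast
    have mem: "x \<in> cell F" "y \<in> cell F" "z \<in> cell F"
      using x y z G T by (auto simp: cell_def)
    have "affine hull {y, z} = affine hull (cell F)"
      using aff_dim_eq_full_gen[of "{y, z}" "cell F"] mem dim \<open>y \<noteq> z\<close> by (simp add: aff_dim_2)
    then have "x \<in> affine hull {y, z}" using mem by (simp add: hull_inc)
    then obtain a b where ab: "a + b = 1" "x = a *\<^sub>R y + b *\<^sub>R z"
      unfolding affine_hull_2 by blast
    have adm: "i \<in> I" "j \<in> J" "i \<le> j" using forestD[OF tree_forest[OF T(1)] ij(1)] by auto
    obtain k where k: "(i, k) \<in> F" using covering_arc_I[OF cov adm(1)] .
    have "crd y j - h i j = crd y k - h i k" "crd z j - h i j = crd z k - h i k"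
      using contacts_eqD[of i k y j] contacts_eqD[of i k z j] k y(2) z(2) ij T G by (auto simp: G_def)
    then have eq: "crd y j = crd y k + (h i j - h i k)" "crd z j = crd z k + (h i j - h i k)" by auto
    have "crd x j = crd x k + (a + b) * (h i j - h i k)"
      unfolding ab(2) crd_linear eq by (simp add: algebra_simps)
    then have "(i, j) \<in> contacts x" using contacts_eqI[of i k x j] k x(2) adm ab(1) by simp
    then show False using ij x(2) by simp
  qed
  moreover have "finite F"
    using cov finite_forest[OF finI finJ] by (simp add: covering_forest_def)
  ultimately show ?thesis using ij tree_card[OF nodes_axioms T(1)] by auto
qed

end

section \<open>Vertices, edges and the final correspondence\<close>

context arrangement
begin

lemma Asso_vertices_eq: "Asso_vertices I e h = cell ` {T. tree I J T}"
  unfolding Asso_vertices_def Asso_eq using aff_dim_cell_0_iff tree_covering by blast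

lemma cell_inj_on: "inj_on cell {F. covering_forest I J F}"
  using cell_subset_iff by (intro inj_onI) (metis mem_Collect_eq order_antisym order_refl)

text \<open>A cell containing both vertices belongs to a forest contained in both trees; dimension 1
  makes it one arc short. For a flip the edge is the cell of \<open>T \<inter> T'\<close>.\<close>

lemma joined_by_edge_iff:
  assumes T: "tree I J T" and T': "tree I J T'"
  shows "joined_by_edge I e h (cell T) (cell T') \<longleftrightarrow> flip_related I J T T'"
proof
  assume "joined_by_edge I e h (cell T) (cell T')"
  then obtain F where F: "covering_forest I J F" "aff_dim (cell F) = 1" "F \<subseteq> T" "F \<subseteq> T'"
    and "T \<noteq> T'"
    unfolding joined_by_edge_def Asso_eq
    using cell_subset_iff[OF tree_covering[OF T]] cell_subset_iff[OF tree_covering[OF T']] by blast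
  then show "flip_related I J T T'"
    using flip_relatedI(1)[OF T T'] edge_cell_card[OF F(1,2) T] by blast
next
  assume flip: "flip_related I J T T'"
  then have "T \<noteq> T'" by (auto simp: flip_related_def)
  then have "cell T \<noteq> cell T'"
    using inj_onD[OF cell_inj_on] tree_covering T T' by blast
  moreover have "cell (T \<inter> T') \<in> Asso I e h"
    unfolding Asso_eq using flip_intersection(2)[OF flip] by blast
  ultimately show "joined_by_edge I e h (cell T) (cell T')"
    unfolding joined_by_edge_def Asso_vertices_eq
    using aff_dim_flip_cell[OF flip] cell_antimono[of "T \<inter> T'"] T T' by blast
qed

end

theorem theorem5p2:
  fixes I J :: "nat set"
    and e :: "'n::finite \<Rightarrow> nat"
    and h :: "nat \<Rightarrow> nat \<Rightarrow> real"
  assumes "finite I" and "I \<noteq> {}"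
    and "finite J" and "J \<noteq> {}"
    and "Min I \<le> Min J"
    and "Max I \<le> Max J"
    and "bij_betw e UNIV J"
    and "\<And>i i' j j'. i \<in> I \<Longrightarrow> i' \<in> I \<Longrightarrow> j \<in> J \<Longrightarrow> j' \<in> J \<Longrightarrow>
           i < i' \<Longrightarrow> i' \<le> j \<Longrightarrow> j < j' \<Longrightarrow> h i j' + h i' j < h i j + h i' j'"
  shows "\<exists>\<phi> :: (real ^ 'n) set \<Rightarrow> arc set.
           bij_betw \<phi> (Asso I e h) (interior_faces (tamari_complex I J)) \<and>
           (\<forall>C \<in> Asso I e h. \<forall>D \<in> Asso I e h. C \<subseteq> D \<longleftrightarrow> \<phi> D \<subseteq> \<phi> C) \<and>
           bij_betw \<phi> (Asso I e h) {F. covering_forest I J F} \<and>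
           bij_betw \<phi> (Asso_vertices I e h) {T. tree I J T} \<and>
           (\<forall>u \<in> Asso_vertices I e h. \<forall>v \<in> Asso_vertices I e h.
              joined_by_edge I e h u v \<longleftrightarrow> flip_related I J (\<phi> u) (\<phi> v)) \<and>
           (\<forall>u \<in> Asso_vertices I e h. \<forall>v \<in> Asso_vertices I e h.
              joined_by_edge I e h u v \<longleftrightarrow> hasse_adjacent I J (\<phi> u) (\<phi> v))"
proof -
  interpret arrangement I J h e
    using assms by unfold_locales auto
  \<comment> \<open>The inverse of \<open>cell\<close>, which is injective on covering forests
    because inclusion of cells reverses inclusion of forests exactly.\<close>
  define \<phi> where "\<phi> = the_inv_into {F. covering_forest I J F} cell"
  have \<phi>_cell: "\<phi> (cell F) = F" if "covering_forest I J F" for F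
    unfolding \<phi>_def using the_inv_into_f_f[OF cell_inj_on] that by blast
  have faces: "bij_betw \<phi> (Asso I e h) {F. covering_forest I J F}"
    unfolding \<phi>_def Asso_eq
    by (intro bij_betw_the_inv_into inj_on_imp_bij_betw cell_inj_on)
  have vertices: "bij_betw \<phi> (Asso_vertices I e h) {T. tree I J T}"
    unfolding Asso_vertices_eq
    by (rule bij_betw_byWitness[where f' = cell]) (use \<phi>_cell tree_covering in auto)
  have order: "C \<subseteq> D \<longleftrightarrow> \<phi> D \<subseteq> \<phi> C" if CD: "C \<in> Asso I e h" "D \<in> Asso I e h" for C D
  proof -
    obtain F G where "covering_forest I J F" "covering_forest I J G" "C = cell F" "D = cell G"
      using CD unfolding Asso_eq by blast
    then show ?thesis using \<phi>_cell cell_subset_iff by simp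
  qed
  have edges: "joined_by_edge I e h u v \<longleftrightarrow> flip_related I J (\<phi> u) (\<phi> v)"
    if "u \<in> Asso_vertices I e h" "v \<in> Asso_vertices I e h" for u v
    using that \<phi>_cell tree_covering joined_by_edge_iff unfolding Asso_vertices_eq by auto
  show ?thesis
    using faces vertices order edges
    by (intro exI[of _ \<phi>]) (simp add: interior_faces_tamari hasse_adjacent_iff)
qed

end
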